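(* Let $f\in L^2(I)$ with $BEP_{2,\infty}$-solution $g_0$. Let $f^{\{n\}}\in L^2(I)$ converge to $f$ in $L^2(I)$ and let $g_0^{\{n\}}$ be the solution to $BEP_{2,\infty}$ with datum $f^{\{n\}}$. Then $g^{\{n\}}_{0}{}_{|_I}\to g_0{}_{|_I}$ in $L^2(I)$ and $g^{\{n\}}_0{}_{|_J}\to g_0{}_{|_J}$ weak-* in $L^\infty(J)$. If moreover $\ell(\partial I)=0$ and $f$ is not the trace on $I$ of an $H^2$-function of modulus at most $1$ a.e. on $J$, then $g_0^{\{n\}}\to g_0$ in $L^2(\mathbb T)$.
   Context: $\mathbb T$ unit circle, $\ell$ normalized Lebesgue measure. $I\subset\mathbb T$ measurable, $J=\mathbb T\setminus I$, $\ell(I)>0,\ell(J)>0$; $\partial I$ boundary of $I$ in $\mathbb T$. $\|h\|_{L^2(E)}=(\frac1{2\pi}\int_E|h|^2d\theta)^{1/2}$. $H^2$ Hardy space (boundary values). Problem $BEP_{2,\infty}$: given $f\in L^2(I)$, find $g_0\in H^2$ with $|g_0|\le1$ a.e. on $J$ minimizing $\|f-g\|_{L^2(I)}$ over $g\in H^2$ with $|g|\le1$ a.e. on $J$; it has a unique solution. *)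

theory Defs
  imports "HOL-Analysis.Analysis"
begin

text \<open>The unit circle is parametrised by the angle in [0, 2 pi); functions on it are
  complex-valued functions of the angle.  Lebesgue measure on the circle is Lebesgue
  measure on [0, 2 pi), normalised by the factor 1/(2 pi) in the norms below.\<close>

definition Tcirc :: "real set" where
  "Tcirc = {0..<2*pi}"

definition in_L2 :: "real set \<Rightarrow> (real \<Rightarrow> complex) \<Rightarrow> bool" where
  "in_L2 E h \<longleftrightarrow> h \<in> borel_measurable (lebesgue_on E) \<and>
                 integrable (lebesgue_on E) (\<lambda>x. (cmod (h x))\<^sup>2)"

definition L2norm :: "real set \<Rightarrow> (real \<Rightarrow> complex) \<Rightarrow> real" where
  "L2norm E h = sqrt ((1 / (2*pi)) * integral\<^sup>L (lebesgue_on E) (\<lambda>x. (cmod (h x))\<^sup>2))"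

text \<open>Hardy space H^2: L^2(T) functions whose Fourier coefficients of negative index vanish.\<close>
definition H2 :: "(real \<Rightarrow> complex) \<Rightarrow> bool" where
  "H2 g \<longleftrightarrow> in_L2 Tcirc g \<and>
     (\<forall>k::nat. k > 0 \<longrightarrow>
        integral\<^sup>L (lebesgue_on Tcirc) (\<lambda>x. g x * exp (\<i> * of_nat k * of_real x)) = 0)"

definition BEP_adm :: "real set \<Rightarrow> (real \<Rightarrow> complex) \<Rightarrow> bool" where
  "BEP_adm J g \<longleftrightarrow> H2 g \<and> (AE x in lebesgue_on J. cmod (g x) \<le> 1)"

definition BEP_sol :: "real set \<Rightarrow> (real \<Rightarrow> complex) \<Rightarrow> (real \<Rightarrow> complex) \<Rightarrow> bool" where
  "BEP_sol I f g0 \<longleftrightarrow> BEP_adm (Tcirc - I) g0 \<and>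
     (\<forall>g. BEP_adm (Tcirc - I) g \<longrightarrow> L2norm I (\<lambda>x. f x - g0 x) \<le> L2norm I (\<lambda>x. f x - g x))"

text \<open>Boundary of I in the circle: frontier of the 2 pi-periodic extension, restricted to T.\<close>
definition circ_boundary :: "real set \<Rightarrow> real set" where
  "circ_boundary I = frontier {x. 2*pi * frac (x / (2*pi)) \<in> I} \<inter> Tcirc"

end

(* On I the solution is the projection of the datum onto a convex set, hence
   depends on it in a nonexpansive way; this gives convergence on I.

   The other two claims rest on one approximation result: if E has positive
   measure, every continuous function on the circle is, off E, a uniform limit
   of bounded analytic functions.  By Stone-Weierstrass it suffices to treat
   1/z, and there (1 - exp v)/z works, with v analytic, v(0) = 0 and Re v very
   negative off E.

   With E = I, testing the differences against such functions gives weak-*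
   convergence on J: they are small on I and bounded on J.  If |g0| were less
   than 1 on a subset E of J of positive measure, the same result would yield
   enough admissible variations of g0 to force g0 = f on I (here the
   boundary of I must be null).  So |g0| = 1 on J when f is not a trace, and
   weak convergence within the unit ball to a unimodular limit is strong. *)

theory Submission
  imports Defs
begin

section \<open>Functions on the circle\<close>

text \<open>Bounded analytic functions are the right test objects because they multiply
  \<open>H2\<close> into itself: the integral of an \<open>H2\<close> function against such a factor
  times \<open>cis\<close> vanishes. They cannot be prescribed on the whole circle: v(0) = 0 forces
  Re v to have mean zero, so very negative values off E are paid for by large positive ones on E,
  and E must have positive measure. Both uses make the uncontrolled size on E harmless: for E = I it
  meets differences that are already small in L^2(I); for E inside J it meets a fixed gap below
  modulus 1, and the step length of the variation shrinks accordingly. The imaginary part of v is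
  the harmonic conjugate of a step function and need not be bounded. Only exp v enters, so a bound
  on Re v suffices, and v is needed only as an almost everywhere limit of polynomials. The boundary
  of I matters because the directions of variation are continuous and vanish on J. They live in the
  interior of I, and detect f - g0 on all of I only if that interior fills I up to a null
  set.\<close>

abbreviation circ :: "real measure" where
  "circ \<equiv> lebesgue_on Tcirc"

lemma Tcirc_lmeasurable: "Tcirc \<in> lmeasurable"
  unfolding Tcirc_def
  by (rule bounded_set_imp_lmeasurable) auto

lemma Tcirc_sets: "Tcirc \<in> sets lebesgue"
  using Tcirc_lmeasurable by blast

lemma finite_measure_circ: "finite_measure circ"
  by (rule finite_measure_lebesgue_on[OF Tcirc_lmeasurable])

lemma measurable_circ: "continuous_on UNIV h \<Longrightarrow> h \<in> borel_measurable circ"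
  for h :: "real \<Rightarrow> 'a::euclidean_space"
  by (intro continuous_imp_measurable_on_sets_lebesgue Tcirc_sets) (auto intro: continuous_on_subset)

lemma measurable_cis [measurable]: "cis \<in> borel_measurable circ"
  by (intro measurable_circ continuous_intros)

text \<open>A continuous map from a compact interval onto a Hausdorff space is a quotient map, and
  \<open>cis\<close> identifies only the two end points. Continuous functions on the circle can
  therefore be built in the angle variable.\<close>

lemma circle_quotient:
  fixes h :: "real \<Rightarrow> 'a::topological_space"
  assumes "continuous_on {0..2*pi} h" and "h 0 = h (2*pi)"
  obtains H where "continuous_on (sphere 0 1) H" "\<And>x. x \<in> {0..2*pi} \<Longrightarrow> H (cis x) = h x"
proof -
  have im: "cis ` {0..2*pi} = sphere 0 1"
  proof
    show "sphere 0 1 \<subseteq> cis ` {0..2*pi}"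
    proof
      fix z :: complex assume z: "z \<in> sphere 0 1"
      have "z = cis (Arg2pi z)"
        using Arg2pi_eq[of z] z by (simp add: cis_conv_exp)
      then show "z \<in> cis ` {0..2*pi}"
        using Arg2pi_ge_0[of z] Arg2pi_lt_2pi[of z] by (intro image_eqI[of _ _ "Arg2pi z"]) auto
    qed
  qed auto
  have q: "quotient_map (top_of_set {0..2*pi}) (top_of_set (sphere 0 1)) cis"
    by (rule continuous_imp_quotient_map)
       (use im in \<open>simp_all add: compact_space_subtopology Hausdorff_space_subtopology continuous_on_cis\<close>)
  have eq: "h x = h y" if "x \<in> {0..2*pi}" "y \<in> {0..2*pi}" "cis x = cis y" for x y
  proof -
    have lem: "h x = h y" if "x \<in> {0..2*pi}" "y \<in> {0..2*pi}" "cis x = cis y" "x < y" for x y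
    proof -
      have "exp (\<i> * of_real x) = exp (\<i> * of_real y)" using that by (simp add: cis_conv_exp)
      then obtain n :: int where n: "\<i> * of_real x = \<i> * of_real y + (of_int (2 * n) * of_real pi) * \<i>"
        unfolding exp_eq by auto
      then have "Im (\<i> * of_real x) = Im (\<i> * of_real y + (of_int (2 * n) * of_real pi) * \<i>)" by metis
      then have n': "x = y + 2 * pi * of_int n" by (simp add: algebra_simps)
      have "of_int n < (0::real)" using n' \<open>x < y\<close> by (simp add: mult_less_0_iff)
      then have "n < 0" by simp
      have "n > -2"
      proof (rule ccontr)
        assume "\<not> n > -2" then have "n \<le> -2" by simp
        then have "of_int n \<le> (-2::real)" by linarith
        then have "2*pi * of_int n \<le> 2*pi * (-2)" by (intro mult_left_mono) auto
        then show False using n' that by auto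
      qed
      then have "n = -1" using \<open>n < 0\<close> by simp
      \<comment> \<open>A gap of one full period leaves only the two ends of the interval; this is
        where \<open>h 0 = h (2*pi)\<close> enters.\<close>
      then have "x = 0" "y = 2*pi" using n' that by auto
      then show ?thesis using assms by simp
    qed
    show ?thesis
      using lem[OF that] lem[OF that(2,1) that(3)[symmetric]] linorder_less_linear[of x y] by metis
  qed
  obtain H where H: "continuous_map (top_of_set (sphere 0 1)) euclidean H"
      "\<And>x. x \<in> topspace (top_of_set {0..2*pi}) \<Longrightarrow> H (cis x) = h x"
  proof (rule quotient_map_lift_exists[OF q])
    show "continuous_map (top_of_set {0..2 * pi}) euclidean h" using assms by simp
  next
    fix x y assume "x \<in> topspace (top_of_set {0..2*pi})" "y \<in> topspace (top_of_set {0..2*pi})" "cis x = cis y"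
    then show "h x = h y" using eq[of x y] by simp
  qed blast
  show thesis
    by (rule that[of H]) (use H in auto)
qed

lemma closest_point_cball:
  fixes z w :: complex
  assumes "K \<ge> 0"
  shows "norm (closest_point (cball 0 K) z) \<le> K"
    and "norm w \<le> K \<Longrightarrow> closest_point (cball 0 K) w = w"
  using closest_point_in_set[of "cball (0::complex) K" z] closest_point_self[of w "cball 0 K"] assms
  by auto

text \<open>Continuous functions converging almost everywhere come from
  \<open>measurable_on\<close>, but without a bound and without matching end values. Projecting to
  the disc of radius \<open>K\<close> repairs the first defect and a cutoff near the ends the
  second; neither disturbs the limit outside a null set.\<close>

lemma bounded_continuous_approx:
  fixes \<phi> :: "real \<Rightarrow> complex"
  assumes m: "\<phi> \<in> borel_measurable circ" and K: "\<And>x. norm (\<phi> x) \<le> K"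
  obtains H :: "nat \<Rightarrow> complex \<Rightarrow> complex"
  where "\<And>n. continuous_on (sphere 0 1) (H n)"
    and "\<And>n z. z \<in> sphere 0 1 \<Longrightarrow> norm (H n z) \<le> K"
    and "AE x in circ. (\<lambda>n. H n (cis x)) \<longlonglongrightarrow> \<phi> x"
proof -
  have K0: "K \<ge> 0" using K[of 0] norm_ge_zero order_trans by blast
  have "\<phi> measurable_on Tcirc"
    using m measurable_on_iff_borel_measurable[OF Tcirc_sets] by blast
  then obtain N g where N: "negligible N" and g: "\<And>n. continuous_on UNIV (g n)"
    and lim: "\<And>x. x \<notin> N \<Longrightarrow> (\<lambda>n. g n x) \<longlonglongrightarrow> (if x \<in> Tcirc then \<phi> x else 0)"
    unfolding measurable_on_def by blast
  let ?P = "closest_point (cball (0::complex) K)"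
  \<comment> \<open>The cutoff vanishes at 0 and 2 pi, so that \<open>G n\<close> descends to the
    circle, and equals 1 eventually at each interior angle.\<close>
  define c where "c n x = min 1 (real n * max 0 (min x (2*pi - x)))" for n x
  define G where "G n x = of_real (c n x) * ?P (g n x)" for n x
  have contP: "continuous_on UNIV ?P"
    by (rule continuous_on_closest_point) (use K0 in auto)
  have contG: "continuous_on {0..2*pi} (G n)" for n
    unfolding G_def c_def
    by (intro continuous_intros continuous_on_compose2[OF contP] continuous_on_subset[OF g]) auto
  have "\<exists>H. continuous_on (sphere 0 1) H \<and> (\<forall>x\<in>{0..2*pi}. H (cis x) = G n x)" for n
    by (rule circle_quotient[OF contG[of n]]) (auto simp: G_def c_def)
  then obtain H where H: "\<And>n. continuous_on (sphere 0 1) (H n)"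
      "\<And>n x. x \<in> {0..2*pi} \<Longrightarrow> H n (cis x) = G n x"
    by metis
  have normG: "norm (G n x) \<le> K" for n x
  proof -
    have "\<bar>c n x\<bar> \<le> 1" unfolding c_def by auto
    then show ?thesis
      unfolding G_def norm_mult using closest_point_cball(1)[OF K0, of "g n x"]
      by (metis mult_mono' mult_1 norm_ge_zero norm_of_real real_norm_def)
  qed
  show thesis
  proof (rule that[of H])
    fix n and z :: complex assume z: "z \<in> sphere 0 1"
    have "z = cis (Arg2pi z)"
      using Arg2pi_eq[of z] z by (simp add: cis_conv_exp)
    moreover have "Arg2pi z \<in> {0..2*pi}"
      using Arg2pi_ge_0[of z] Arg2pi_lt_2pi[of z] by auto
    ultimately show "norm (H n z) \<le> K" using H(2) normG by metis
  next
    have "N \<union> {0} \<in> null_sets lebesgue"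
      using N by (simp add: negligible_iff_null_sets[symmetric])
    then have "AE x in lebesgue. x \<notin> N \<union> {0}" by (rule AE_not_in)
    then have "AE x in circ. x \<notin> N \<union> {0}"
      using Tcirc_sets by (subst AE_restrict_space_iff) auto
    moreover have "AE x in circ. x \<in> Tcirc"
      by (metis AE_space space_lebesgue_on)
    ultimately show "AE x in circ. (\<lambda>n. H n (cis x)) \<longlonglongrightarrow> \<phi> x"
    proof eventually_elim
      case (elim x)
      then have x: "0 < x" "x < 2*pi" "x \<notin> N" by (auto simp: Tcirc_def)
      have P: "isCont ?P (\<phi> x)" using contP by (simp add: continuous_on_eq_continuous_at)
      have "(\<lambda>n. ?P (g n x)) \<longlonglongrightarrow> ?P (\<phi> x)"
        using lim[OF x(3)] elim by (intro isCont_tendsto_compose[OF P]) auto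
      then have 1: "(\<lambda>n. ?P (g n x)) \<longlonglongrightarrow> \<phi> x" using closest_point_cball(2)[OF K0 K] by simp
      have 2: "eventually (\<lambda>n. G n x = ?P (g n x)) sequentially"
      proof -
        define d where "d = max 0 (min x (2*pi - x))"
        have "d > 0" using x by (auto simp: d_def)
        then obtain n0 :: nat where n0: "1 < real n0 * d" using reals_Archimedean3 by blast
        have "c n x = 1" if "n \<ge> n0" for n
        proof -
          have "real n0 * d \<le> real n * d" using that \<open>d > 0\<close> by (intro mult_right_mono) auto
          then show ?thesis using n0 unfolding c_def d_def[symmetric] by auto
        qed
        then show ?thesis unfolding eventually_sequentially G_def by (intro exI[of _ n0]) auto
      qed
      have "(\<lambda>n. G n x) \<longlonglongrightarrow> \<phi> x" using 1 2 tendsto_cong by fast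
      then show ?case using H(2)[of x] x by simp
    qed
  qed (use H in auto)
qed

section \<open>Analytic polynomials on the circle\<close>

text \<open>On the circle \<open>z * cnj z = 1\<close>, so every mixed monomial in \<open>z\<close> and \<open>cnj z\<close> reduces to a power of
  one of them, and conjugation does not change real parts.\<close>

lemma circle_real_polynomial_mult:
  obtains s where "\<And>z::complex. norm z = 1 \<Longrightarrow> Re (poly p z) * Re (poly q z) = Re (poly s z)"
proof -
  \<comment> \<open>Pairing \<open>p\<close> with the conjugate of \<open>q\<close> makes the
    induction close: removing one factor \<open>z\<close> from each leaves
    \<open>z * cnj z = 1\<close> times a pair of the same kind.\<close>
  have "\<exists>s. \<forall>z::complex. norm z = 1 \<longrightarrow> Re (poly p z * cnj (poly q z)) = Re (poly s z)"
  proof (induction p arbitrary: q)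
    case 0
    show ?case by (rule exI[of _ 0]) simp
  next
    case (pCons a p)
    obtain b q' where q: "q = pCons b q'" by (cases q) auto
    obtain s where s: "norm z = 1 \<Longrightarrow> Re (poly p z * cnj (poly q' z)) = Re (poly s z)" for z :: complex
      using pCons.IH by metis
    show ?case
    proof (intro exI[of _ "smult (cnj a) q + pCons 0 (smult (cnj b) p) + s"] allI impI)
      fix z :: complex assume z: "norm z = 1"
      have zz: "z * cnj z = 1" using z by (simp add: complex_norm_square[symmetric])
      have "poly (pCons a p) z * cnj (poly q z) =
          a * cnj (poly q z) + z * poly p z * cnj b + (z * cnj z) * (poly p z * cnj (poly q' z))"
        unfolding q by (simp add: algebra_simps)
      moreover have "Re (a * cnj (poly q z)) = Re (cnj a * poly q z)" by simp
      ultimately show "Re (poly (pCons a p) z * cnj (poly q z))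
          = Re (poly (smult (cnj a) q + pCons 0 (smult (cnj b) p) + s) z)"
        using s[OF z] unfolding zz by (simp add: algebra_simps)
    qed
  qed
  then obtain s where s: "norm z = 1 \<Longrightarrow> Re (poly p z * cnj (poly q z)) = Re (poly s z)" for z :: complex
    by metis
  show thesis
  \<comment> \<open>Re a * Re b is half the sum of Re (a * b) and Re (a * cnj b).\<close>
  proof (rule that[of "smult (1/2) (p * q + s)"])
    fix z :: complex assume "norm z = 1"
    then show "Re (poly p z) * Re (poly q z) = Re (poly (smult (1/2) (p * q + s)) z)"
      using s[of z] by (simp add: field_simps)
  qed
qed

text \<open>Real parts of analytic polynomials form an algebra on the circle by the preceding lemma
  and separate points, so the real Stone-Weierstrass theorem applies. For complex values the
  analogue fails: polynomials in \<open>z\<close> alone do not approximate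
  \<open>1/z\<close>.\<close>

lemma circle_real_polynomial_approx:
  fixes h :: "complex \<Rightarrow> real"
  assumes h: "continuous_on (sphere 0 1) h" and e: "e > 0"
  obtains p where "\<And>z. norm z = 1 \<Longrightarrow> \<bar>h z - Re (poly p z)\<bar> < e"
proof -
  define R where "R = {f. \<exists>p. \<forall>z\<in>sphere (0::complex) 1. f z = Re (poly p z)}"
  interpret function_ring_on R "sphere (0::complex) 1"
  proof
    fix f assume "f \<in> R"
    then obtain p where p: "\<forall>z\<in>sphere (0::complex) 1. f z = Re (poly p z)" by (auto simp: R_def)
    have "continuous_on (sphere 0 1) (\<lambda>z. Re (poly p z))" by (intro continuous_intros)
    then show "continuous_on (sphere 0 1) f"
      using p continuous_on_cong[of "sphere 0 1" "sphere 0 1" f "\<lambda>z. Re (poly p z)"] by blast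
  next
    fix f g assume "f \<in> R" "g \<in> R"
    then obtain p q where p: "\<forall>z\<in>sphere (0::complex) 1. f z = Re (poly p z)"
      and q: "\<forall>z\<in>sphere (0::complex) 1. g z = Re (poly q z)" by (auto simp: R_def)
    show "(\<lambda>x. f x + g x) \<in> R"
      unfolding R_def using p q by (auto intro!: exI[of _ "p + q"])
    obtain s where "\<And>z::complex. norm z = 1 \<Longrightarrow> Re (poly p z) * Re (poly q z) = Re (poly s z)"
      using circle_real_polynomial_mult by blast
    then show "(\<lambda>x. f x * g x) \<in> R"
      unfolding R_def using p q by (auto intro!: exI[of _ s])
  next
    fix c show "(\<lambda>_. c) \<in> R" unfolding R_def by (auto intro!: exI[of _ "[:of_real c:]"])
  next
    fix x y :: complex assume "x \<noteq> y"
    moreover have "Re \<in> R" unfolding R_def by (auto intro!: exI[of _ "[:0, 1:]"])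
    moreover have "Im \<in> R" unfolding R_def by (auto intro!: exI[of _ "[:0, -\<i>:]"])
    ultimately show "\<exists>f\<in>R. f x \<noteq> f y" by (auto simp: complex_eq_iff)
  qed auto
  show thesis using Stone_Weierstrass_basic[OF h e] that unfolding R_def by force
qed

text \<open>The L^1 version of \<open>H2\<close>, that is the Hardy space H^1: the integral against
  \<open>cis x ^ k\<close> is, up to a factor, the Fourier coefficient of index -k. Integrability is
  all that pairing with bounded functions requires.\<close>

definition analytic_type :: "(real \<Rightarrow> complex) \<Rightarrow> bool" where
  "analytic_type G \<longleftrightarrow> integrable circ G \<and> (\<forall>k>0. (\<integral>x. G x * cis x ^ k \<partial>circ) = 0)"

lemma integrable_mult_bounded:
  fixes G H :: "real \<Rightarrow> complex"
  assumes G: "integrable M G" and H: "H \<in> borel_measurable M" and b: "AE x in M. norm (H x) \<le> B"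
  shows "integrable M (\<lambda>x. G x * H x)"
proof (rule Bochner_Integration.integrable_bound)
  show "integrable M (\<lambda>x. B * norm (G x))" using G by auto
  show "(\<lambda>x. G x * H x) \<in> borel_measurable M" using G H by measurable
  show "AE x in M. norm (G x * H x) \<le> norm (B * norm (G x))"
    using b
  proof eventually_elim
    case (elim x)
    have "norm (G x) * norm (H x) \<le> norm (G x) * \<bar>B\<bar>" using elim by (intro mult_left_mono) auto
    then show ?case by (simp add: norm_mult abs_mult mult.commute)
  qed
qed

lemma poly_cis_measurable [measurable]: "(\<lambda>x. poly p (cis x)) \<in> borel_measurable circ"
  by (intro measurable_circ continuous_intros)

lemma poly_cis_bounded: "\<exists>B>0. \<forall>x. norm (poly p (cis x)) \<le> B"
proof -
  have "compact (poly p ` sphere 0 1)"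
    by (intro compact_continuous_image continuous_intros) auto
  then obtain B where "B > 0" "\<forall>w\<in>poly p ` sphere 0 1. norm w \<le> B"
    using compact_imp_bounded bounded_pos by metis
  then show ?thesis by auto
qed

lemma integrable_mult_poly_cis:
  assumes "integrable circ G"
  shows "integrable circ (\<lambda>x. G x * poly p (cis x))"
proof -
  obtain B where "\<forall>x. norm (poly p (cis x)) \<le> B" using poly_cis_bounded by blast
  then show ?thesis by (intro integrable_mult_bounded[OF assms, of _ B]) auto
qed

lemma analytic_type_mult_cis:
  assumes "analytic_type G"
  shows "analytic_type (\<lambda>x. G x * cis x)"
  unfolding analytic_type_def
proof (intro conjI allI impI)
  show "integrable circ (\<lambda>x. G x * cis x)"
    using assms integrable_mult_poly_cis[of G "[:0,1:]"] by (simp add: analytic_type_def)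
  fix k :: nat
  have "(\<integral>x. G x * cis x ^ Suc k \<partial>circ) = 0"
    using assms unfolding analytic_type_def by blast
  then show "(\<integral>x. G x * cis x * cis x ^ k \<partial>circ) = 0" by (simp only: power_Suc mult.assoc)
qed

lemma analytic_type_mult_cis_power:
  assumes "analytic_type G"
  shows "analytic_type (\<lambda>x. G x * cis x ^ k)"
proof (induction k)
  case (Suc k)
  from analytic_type_mult_cis[OF this] show ?case by (simp only: power_Suc2 mult.assoc)
qed (use assms in simp)

text \<open>Evaluation at the centre of the disc is multiplicative on analytic functions.
  \<open>G\<close> is arbitrary in the induction because peeling off a coefficient of
  \<open>p\<close> replaces \<open>G\<close> by \<open>G x * cis x\<close>, whose mean is
  zero.\<close>

lemma analytic_type_integral_poly:
  "analytic_type G \<Longrightarrow> (\<integral>x. G x * poly p (cis x) \<partial>circ) = poly p 0 * (\<integral>x. G x \<partial>circ)"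
proof (induction p arbitrary: G)
  case (pCons a p)
  have i: "integrable circ G" "integrable circ (\<lambda>x. G x * cis x)"
    using pCons.prems analytic_type_mult_cis unfolding analytic_type_def by blast+
  have z: "(\<integral>x. G x * cis x \<partial>circ) = 0"
    using pCons.prems[unfolded analytic_type_def, THEN conjunct2, rule_format, of 1] by simp
  have "(\<integral>x. G x * poly (pCons a p) (cis x) \<partial>circ)
      = (\<integral>x. G x * a + (G x * cis x) * poly p (cis x) \<partial>circ)"
    by (simp only: poly_pCons ring_distribs mult_ac)
  also have "\<dots> = (\<integral>x. G x * a \<partial>circ) + (\<integral>x. (G x * cis x) * poly p (cis x) \<partial>circ)"
    by (intro Bochner_Integration.integral_add integrable_mult_left integrable_mult_poly_cis i)
  also have "\<dots> = a * (\<integral>x. G x \<partial>circ)"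
    using pCons.IH[OF analytic_type_mult_cis[OF pCons.prems]] z by simp
  finally show ?case by simp
qed simp

text \<open>In the exponential series every power \<open>p ^ n\<close> with n > 0 vanishes at 0 and
  contributes nothing by the preceding lemma. Sum and integral may be exchanged because
  \<open>p\<close> is bounded on the circle, which gives the majorant
  \<open>B ^ n / fact n\<close>.\<close>

lemma analytic_type_integral_exp:
  assumes G: "analytic_type G" and p: "poly p 0 = 0"
  shows "(\<integral>x. G x * exp (poly p (cis x)) \<partial>circ) = (\<integral>x. G x \<partial>circ)"
proof -
  obtain B where B: "B > 0" "\<And>x. norm (poly p (cis x)) \<le> B" using poly_cis_bounded by blast
  have iG: "integrable circ G" using G by (simp add: analytic_type_def)
  let ?f = "\<lambda>n x. G x * (poly p (cis x) ^ n /\<^sub>R fact n)"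
  have f_eq: "?f n = (\<lambda>x. (G x * poly (p ^ n) (cis x)) /\<^sub>R fact n)" for n by (auto simp: poly_power)
  have i: "integrable circ (?f n)" for n
    unfolding f_eq by (intro integrable_scaleR_right integrable_mult_poly_cis iG)
  have nf: "norm (?f n x) \<le> norm (G x) * (B ^ n /\<^sub>R fact n)" for n x
    using B by (auto simp: norm_mult norm_power intro!: mult_left_mono power_mono)
  have sB: "summable (\<lambda>n. B ^ n /\<^sub>R fact n)" by (rule summable_exp_generic)
  have "(\<lambda>n. integral\<^sup>L circ (?f n)) sums (\<integral>x. (\<Sum>n. ?f n x) \<partial>circ)"
  proof (rule sums_integral[OF i])
    show "AE x in circ. summable (\<lambda>n. norm (?f n x))"
      using nf by (intro AE_I2 summable_comparison_test'[OF summable_mult[OF sB], of 0]) auto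
    show "summable (\<lambda>n. \<integral>x. norm (?f n x) \<partial>circ)"
    proof (rule summable_comparison_test'[OF summable_mult[OF sB, of "\<integral>x. norm (G x) \<partial>circ"], of 0])
      fix n
      have "(\<integral>x. norm (?f n x) \<partial>circ) \<le> (\<integral>x. norm (G x) * (B ^ n /\<^sub>R fact n) \<partial>circ)"
        by (intro integral_mono nf integrable_norm[OF i] integrable_mult_left integrable_norm iG)
      also have "\<dots> = (\<integral>x. norm (G x) \<partial>circ) * (B ^ n /\<^sub>R fact n)" by simp
      finally show "norm (\<integral>x. norm (?f n x) \<partial>circ) \<le> (\<integral>x. norm (G x) \<partial>circ) * (B ^ n /\<^sub>R fact n)"
        by (simp add: integral_nonneg_AE)
    qed
  qed
  moreover have "integral\<^sup>L circ (?f n) = (if n = 0 then (\<integral>x. G x \<partial>circ) else 0)" for n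
    unfolding f_eq using analytic_type_integral_poly[OF G, of "p ^ n"] p by (simp add: poly_power)
  moreover have "(\<Sum>n. ?f n x) = G x * exp (poly p (cis x))" for x
    unfolding exp_def by (rule suminf_mult[OF summable_exp_generic])
  ultimately have "(\<lambda>n. if n = 0 then (\<integral>x. G x \<partial>circ) else 0) sums (\<integral>x. G x * exp (poly p (cis x)) \<partial>circ)"
    by simp
  moreover have "(\<lambda>n. if n = 0 then (\<integral>x. G x \<partial>circ) else 0) sums (\<integral>x. G x \<partial>circ)"
    using sums_single[of 0 "\<lambda>_. \<integral>x. G x \<partial>circ"] by simp
  ultimately show ?thesis by (rule sums_unique2)
qed

lemma analytic_type_1: "analytic_type (\<lambda>x. 1)"
proof -
  interpret finite_measure circ by (rule finite_measure_circ)
  have "(\<integral>x. cis x ^ k \<partial>circ) = 0" if k: "k > 0" for k :: nat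
  proof -
    have hv: "((\<lambda>x. cis (real k * x) / (\<i> * of_nat k)) has_vector_derivative cis (real k * x)) (at x within S)"
      for x S
    proof -
      have "((\<lambda>z. exp (z * (\<i> * of_nat k)) / (\<i> * of_nat k)) has_field_derivative
          exp (of_real x * (\<i> * of_nat k))) (at (of_real x))"
        using k by (auto intro!: derivative_eq_intros)
      from has_vector_derivative_real_field[OF this, of S] show ?thesis
        by (simp add: cis_conv_exp mult_ac)
    qed
    have "((\<lambda>x. cis (real k * x)) has_integral
        cis (real k * (2*pi)) / (\<i> * of_nat k) - cis (real k * 0) / (\<i> * of_nat k)) {0..2*pi}"
      by (intro fundamental_theorem_of_calculus hv) auto
    moreover have "cis (real k * (2*pi)) = 1"
      using cis_multiple_2pi[of "real k"] by (simp add: mult_ac)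
    ultimately have "((\<lambda>x. cis x ^ k) has_integral 0) {0..2*pi}" by (simp add: Complex.DeMoivre)
    then have "((\<lambda>x. cis x ^ k) has_integral 0) Tcirc"
      unfolding Tcirc_def by (rule has_integral_spike_set_eq[THEN iffD1, rotated -1]) (auto intro: negligible_subset[of "{2*pi}"])
    moreover have "integrable circ (\<lambda>x. cis x ^ k)"
      by (rule integrable_const_bound[of _ 1]) (auto simp: norm_power)
    ultimately show ?thesis
      using has_integral_integral_lebesgue_on[OF _ Tcirc_sets] has_integral_unique by blast
  qed
  then show ?thesis by (auto simp: analytic_type_def)
qed

section \<open>Harmonic conjugation\<close>

text \<open>By monotone convergence the sum of the norms has finite integral, hence is finite almost
  everywhere. This turns geometric L^1 bounds into pointwise convergence without passing to
  subsequences.\<close>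

lemma AE_summable_norm:
  fixes F :: "nat \<Rightarrow> 'a \<Rightarrow> 'b::{banach, second_countable_topology}"
  assumes i: "\<And>n. integrable M (F n)" and s: "summable (\<lambda>n. \<integral>x. norm (F n x) \<partial>M)"
  shows "AE x in M. summable (\<lambda>n. norm (F n x))"
proof -
  have [measurable]: "F n \<in> borel_measurable M" for n using i[of n] by (rule borel_measurable_integrable)
  have "(\<integral>\<^sup>+ x. (\<Sum>n. ennreal (norm (F n x))) \<partial>M) = (\<Sum>n. \<integral>\<^sup>+ x. ennreal (norm (F n x)) \<partial>M)"
    by (rule nn_integral_suminf) measurable
  also have "\<dots> = (\<Sum>n. ennreal (\<integral>x. norm (F n x) \<partial>M))"
    by (intro suminf_cong nn_integral_eq_integral integrable_norm i) auto
  finally have eq: "(\<integral>\<^sup>+ x. (\<Sum>n. ennreal (norm (F n x))) \<partial>M) = (\<Sum>n. ennreal (\<integral>x. norm (F n x) \<partial>M))" .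
  have "AE x in M. (\<Sum>n. ennreal (norm (F n x))) \<noteq> \<infinity>"
  proof (rule nn_integral_PInf_AE)
    show "(\<integral>\<^sup>+ x. (\<Sum>n. ennreal (norm (F n x))) \<partial>M) \<noteq> \<infinity>"
      unfolding eq infinity_ennreal_def by (rule ennreal_suminf_neq_top[OF s]) (rule integral_nonneg_AE, simp)
  qed measurable
  then show ?thesis
    unfolding infinity_ennreal_def by eventually_elim (rule summable_suminf_not_top, simp_all)
qed

lemma measure_circ [simp]: "measure circ Tcirc = 2 * pi"
  by (simp add: measure_restrict_space Tcirc_sets Tcirc_def)

lemma integral_circ_const: "(\<integral>x. c \<partial>circ) = (2 * pi) *\<^sub>R c" for c :: "'a::euclidean_space"
proof -
  interpret finite_measure circ by (rule finite_measure_circ)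
  show ?thesis using measure_circ by simp
qed

lemma integrable_circ_bounded:
  fixes f :: "real \<Rightarrow> 'a::euclidean_space"
  assumes "f \<in> borel_measurable circ" "AE x in circ. norm (f x) \<le> B"
  shows "integrable circ f"
  using finite_measure.integrable_const_bound[OF finite_measure_circ] assms by blast

lemma integrable_poly_cis: "integrable circ (\<lambda>x. poly p (cis x))"
proof -
  obtain B where "\<forall>x. norm (poly p (cis x)) \<le> B" using poly_cis_bounded by blast
  then show ?thesis by (intro integrable_circ_bounded[of _ B]) auto
qed

lemma integral_poly_cis: "(\<integral>x. poly p (cis x) \<partial>circ) = 2 * pi * poly p 0"
  using analytic_type_integral_poly[OF analytic_type_1, of p] by (simp add: integral_circ_const scaleR_conv_of_real)

lemma sphere_cis: "cis x \<in> sphere 0 1"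
  by simp

lemma continuous_circle_measurable:
  fixes H :: "complex \<Rightarrow> 'a::euclidean_space"
  assumes "continuous_on (sphere 0 1) H"
  shows "(\<lambda>x. H (cis x)) \<in> borel_measurable circ"
  by (intro measurable_circ continuous_on_compose2[OF assms] continuous_intros) auto

text \<open>A continuous function close to \<open>u\<close> in L^1 is replaced by the real part of a
  polynomial \<open>q\<close>, uniformly close on the circle, and the constant term of
  \<open>q\<close> is then removed. The bound doubles because both Re q and its mean
  \<open>r\<close> are at most \<open>K + 1\<close> in modulus.\<close>

lemma bounded_real_poly_approx:
  fixes u :: "real \<Rightarrow> real"
  assumes m: "u \<in> borel_measurable circ" and K: "\<And>x. \<bar>u x\<bar> \<le> K"
    and z: "(\<integral>x. u x \<partial>circ) = 0" and e: "e > 0"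
  obtains p where "poly p 0 = 0" "\<And>x. \<bar>Re (poly p (cis x))\<bar> \<le> 2 * (K + 1)"
    "(\<integral>x. \<bar>Re (poly p (cis x)) - u x\<bar> \<partial>circ) \<le> e"
proof -
  have iu: "integrable circ u" using K by (intro integrable_circ_bounded[OF m, of K]) auto
  obtain H where H: "\<And>n. continuous_on (sphere 0 1) (H n)"
      "\<And>n z. z \<in> sphere 0 1 \<Longrightarrow> norm (H n z) \<le> K"
      "AE x in circ. (\<lambda>n. H n (cis x)) \<longlonglongrightarrow> complex_of_real (u x)"
    using bounded_continuous_approx[of "\<lambda>x. complex_of_real (u x)" K] m K by auto
  have bH: "\<bar>Re (H n (cis x))\<bar> \<le> K" for n x
    using H(2)[OF sphere_cis, of n x] abs_Re_le_cmod[of "H n (cis x)"] by linarith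
  have [measurable]: "(\<lambda>x. H n (cis x)) \<in> borel_measurable circ" for n
    by (rule continuous_circle_measurable[OF H(1)])
  note [measurable] = m
  have "(\<lambda>n. \<integral>x. \<bar>Re (H n (cis x)) - u x\<bar> \<partial>circ) \<longlonglongrightarrow> (\<integral>x. 0 \<partial>circ)"
  proof (rule integral_dominated_convergence[where w = "\<lambda>x. 2 * K"])
    show "AE x in circ. (\<lambda>n. \<bar>Re (H n (cis x)) - u x\<bar>) \<longlonglongrightarrow> 0"
      using H(3)
    proof eventually_elim
      case (elim x)
      have "(\<lambda>n. \<bar>Re (H n (cis x)) - u x\<bar>) \<longlonglongrightarrow> \<bar>Re (complex_of_real (u x)) - u x\<bar>"
        by (intro tendsto_intros elim)
      then show ?case by simp
    qed
    show "AE x in circ. norm \<bar>Re (H n (cis x)) - u x\<bar> \<le> 2 * K" for n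
    proof (rule AE_I2)
      fix x show "norm \<bar>Re (H n (cis x)) - u x\<bar> \<le> 2 * K"
        using bH[of n x] K[of x] by (simp add: abs_le_iff)
    qed
    show "integrable circ (\<lambda>x. 2 * K)" by (rule integrable_circ_bounded[of _ "norm (2*K)"]) auto
  qed measurable
  then have lim: "(\<lambda>n. \<integral>x. \<bar>Re (H n (cis x)) - u x\<bar> \<partial>circ) \<longlonglongrightarrow> 0" by simp
  \<comment> \<open>Approximating by \<open>q\<close> and removing its constant term each cost at
    most \<open>d * (1 + 2 * pi)\<close> in L^1; the minimum with 1 keeps Re q below
    \<open>K + 1\<close>.\<close>
  define d where "d = min 1 (e / (2 * (1 + 2 * pi)))"
  have d: "0 < d" "d \<le> 1" "d * (2 * (1 + 2 * pi)) \<le> e"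
  proof -
    have p: "0 < 2 * (1 + 2 * pi)" by (intro mult_pos_pos add_pos_pos) auto
    show "0 < d" "d \<le> 1" using e p unfolding d_def by auto
    have "d \<le> e / (2 * (1 + 2 * pi))" unfolding d_def by auto
    then show "d * (2 * (1 + 2 * pi)) \<le> e" using p by (simp only: pos_le_divide_eq)
  qed
  obtain n where n: "(\<integral>x. \<bar>Re (H n (cis x)) - u x\<bar> \<partial>circ) < d"
    using order_tendstoD(2)[OF lim d(1)] eventually_happens by fastforce
  have "continuous_on (sphere 0 1) (\<lambda>z. Re (H n z))" by (intro continuous_intros H)
  then obtain q where q: "\<And>z. norm z = 1 \<Longrightarrow> \<bar>Re (H n z) - Re (poly q z)\<bar> < d"
    using circle_real_polynomial_approx d(1) by blast
  have q': "\<bar>Re (H n (cis x)) - Re (poly q (cis x))\<bar> < d" for x using q[of "cis x"] by simp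
  define r where "r = Re (poly q 0)"
  have iq: "integrable circ (\<lambda>x. Re (poly q (cis x)))" using integrable_poly_cis by auto
  have iH: "integrable circ (\<lambda>x. Re (H n (cis x)))"
    by (rule integrable_circ_bounded[of _ K]) (use bH in auto)
  have ic: "integrable circ (\<lambda>x. c)" for c :: real by (rule integrable_circ_bounded[of _ "norm c"]) auto
  have rq: "2 * pi * r = (\<integral>x. Re (poly q (cis x)) \<partial>circ)"
    using integral_Re[OF integrable_poly_cis, of q] integral_poly_cis[of q] by (simp add: r_def)
  have bq: "\<bar>Re (poly q (cis x))\<bar> \<le> K + 1" for x using bH[of n x] q'[of x] d by linarith
  have "\<bar>2 * pi * r\<bar> \<le> (\<integral>x. \<bar>Re (poly q (cis x))\<bar> \<partial>circ)" unfolding rq by (rule integral_abs_bound)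
  also have "\<dots> \<le> (\<integral>x. K + 1 \<partial>circ)" by (intro integral_mono integrable_abs iq ic bq)
  also have "\<dots> = 2 * pi * (K + 1)" by (simp add: integral_circ_const)
  finally have r1: "\<bar>r\<bar> \<le> K + 1" by (simp add: abs_mult)
  have I1: "(\<integral>x. \<bar>Re (poly q (cis x)) - u x\<bar> \<partial>circ) \<le> d * (1 + 2 * pi)"
  proof -
    have "(\<integral>x. \<bar>Re (poly q (cis x)) - u x\<bar> \<partial>circ) \<le> (\<integral>x. \<bar>Re (H n (cis x)) - u x\<bar> + d \<partial>circ)"
    proof (rule integral_mono)
      fix x show "\<bar>Re (poly q (cis x)) - u x\<bar> \<le> \<bar>Re (H n (cis x)) - u x\<bar> + d"
        using q'[of x] by linarith
    qed (use iq iu iH ic in auto)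
    also have "\<dots> = (\<integral>x. \<bar>Re (H n (cis x)) - u x\<bar> \<partial>circ) + (\<integral>x. d \<partial>circ)"
      by (rule Bochner_Integration.integral_add) (use iu iH ic in auto)
    also have "\<dots> \<le> d + 2 * pi * d" using n by (simp add: integral_circ_const)
    finally show ?thesis by (simp add: algebra_simps)
  qed
  \<comment> \<open>Since \<open>u\<close> has mean zero, the mean of Re q is itself controlled by
    the L^1 error.\<close>
  have "\<bar>2 * pi * r\<bar> = \<bar>\<integral>x. Re (poly q (cis x)) - u x \<partial>circ\<bar>"
    using Bochner_Integration.integral_diff[OF iq iu] z rq by simp
  also have "\<dots> \<le> (\<integral>x. \<bar>Re (poly q (cis x)) - u x\<bar> \<partial>circ)" by (rule integral_abs_bound)
  finally have r2: "\<bar>2 * pi * r\<bar> \<le> d * (1 + 2 * pi)" using I1 by linarith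
  show thesis
  proof (rule that[of "q - [:poly q 0:]"])
    show "poly (q - [:poly q 0:]) 0 = 0" by simp
    fix x
    show "\<bar>Re (poly (q - [:poly q 0:]) (cis x))\<bar> \<le> 2 * (K + 1)"
      using bq[of x] r1 by (simp add: r_def abs_le_iff)
  next
    have "(\<integral>x. \<bar>Re (poly (q - [:poly q 0:]) (cis x)) - u x\<bar> \<partial>circ)
        \<le> (\<integral>x. \<bar>Re (poly q (cis x)) - u x\<bar> + \<bar>r\<bar> \<partial>circ)"
    proof (rule integral_mono)
      fix x show "\<bar>Re (poly (q - [:poly q 0:]) (cis x)) - u x\<bar> \<le> \<bar>Re (poly q (cis x)) - u x\<bar> + \<bar>r\<bar>"
        by (simp add: r_def)
    qed (use iq iu ic in \<open>auto\<close>)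
    also have "\<dots> = (\<integral>x. \<bar>Re (poly q (cis x)) - u x\<bar> \<partial>circ) + (\<integral>x. \<bar>r\<bar> \<partial>circ)"
      by (rule Bochner_Integration.integral_add) (use iu iq ic in auto)
    also have "\<dots> \<le> d * (1 + 2 * pi) + d * (1 + 2 * pi)"
      using I1 r2 by (simp add: integral_circ_const abs_mult)
    also have "\<dots> \<le> e" using d(3) by (simp add: algebra_simps)
    finally show "(\<integral>x. \<bar>Re (poly (q - [:poly q 0:]) (cis x)) - u x\<bar> \<partial>circ) \<le> e" .
  qed
qed

text \<open>Because \<open>poly (p\<^sup>2) 0 = 0\<close>, the mean of \<open>p\<^sup>2\<close> over the circle vanishes, which makes the
  \<open>L\<^sup>2\<close>-norms of \<open>Re p\<close> and \<open>Im p\<close> equal; the parameter \<open>t\<close> comes from AM-GM.\<close>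

lemma integral_norm_poly_cis_le:
  assumes p: "poly p 0 = 0" and C: "\<And>x. \<bar>Re (poly p (cis x))\<bar> \<le> C" and t: "t > 0"
  shows "(\<integral>x. norm (poly p (cis x)) \<partial>circ) \<le> pi * t + (C / t) * (\<integral>x. \<bar>Re (poly p (cis x))\<bar> \<partial>circ)"
proof -
  let ?f = "\<lambda>x. poly p (cis x)"
  have i: "integrable circ ?f" and i2: "integrable circ (\<lambda>x. Re ((?f x)\<^sup>2))"
    using integrable_poly_cis[of p] integrable_poly_cis[of "p^2"] by (auto simp: poly_power)
  have ic: "integrable circ (\<lambda>x. c)" for c :: real by (rule integrable_circ_bounded[of _ "norm c"]) auto
  have I0: "(\<integral>x. Re ((?f x)\<^sup>2) \<partial>circ) = 0"
    using integral_Re[OF integrable_poly_cis, of "p^2"] integral_poly_cis[of "p^2"] p by (simp add: poly_power)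
  \<comment> \<open>The identity |w|^2 = 2 (Re w)^2 - Re (w^2) trades the squared modulus for the
    real part and a term of mean zero.\<close>
  have pw: "norm (?f x) \<le> t / 2 + (C / t * \<bar>Re (?f x)\<bar> - Re ((?f x)\<^sup>2) / (2 * t))" for x
  proof -
    have "2 * t * norm (?f x) \<le> t\<^sup>2 + (norm (?f x))\<^sup>2"
      using zero_le_power2[of "t - norm (?f x)"] by (simp add: power2_diff algebra_simps)
    also have "(norm (?f x))\<^sup>2 = 2 * (Re (?f x))\<^sup>2 - Re ((?f x)\<^sup>2)"
      by (simp add: cmod_power2 Re_power2)
    also have "(Re (?f x))\<^sup>2 \<le> C * \<bar>Re (?f x)\<bar>"
      using mult_right_mono[OF C[of x], of "\<bar>Re (?f x)\<bar>"] by (simp add: power2_eq_square)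
    finally have "2 * t * norm (?f x) \<le> t\<^sup>2 + (2 * (C * \<bar>Re (?f x)\<bar>) - Re ((?f x)\<^sup>2))" by simp
    then have "norm (?f x) \<le> (t\<^sup>2 + (2 * (C * \<bar>Re (?f x)\<bar>) - Re ((?f x)\<^sup>2))) / (2 * t)"
      using t by (subst pos_le_divide_eq) (auto simp: mult_ac)
    also have "\<dots> = t / 2 + (C / t * \<bar>Re (?f x)\<bar> - Re ((?f x)\<^sup>2) / (2 * t))"
      using t by (simp add: field_simps power2_eq_square)
    finally show ?thesis .
  qed
  have ii: "integrable circ (\<lambda>x. C / t * \<bar>Re (?f x)\<bar>)" "integrable circ (\<lambda>x. Re ((?f x)\<^sup>2) / (2 * t))"
    using i i2 by auto
  have "(\<integral>x. norm (?f x) \<partial>circ) \<le> (\<integral>x. t / 2 + (C / t * \<bar>Re (?f x)\<bar> - Re ((?f x)\<^sup>2) / (2 * t)) \<partial>circ)"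
    by (intro integral_mono pw integrable_norm i Bochner_Integration.integrable_add
        Bochner_Integration.integrable_diff ic ii)
  also have "\<dots> = (\<integral>x. t / 2 \<partial>circ) + ((\<integral>x. C / t * \<bar>Re (?f x)\<bar> \<partial>circ) - (\<integral>x. Re ((?f x)\<^sup>2) / (2 * t) \<partial>circ))"
    using ii ic by (simp only: Bochner_Integration.integral_add Bochner_Integration.integral_diff Bochner_Integration.integrable_diff)
  also have "\<dots> = pi * t + (C / t) * (\<integral>x. \<bar>Re (?f x)\<bar> \<partial>circ)"
    using I0 by (simp add: integral_circ_const)
  finally show ?thesis .
qed

text \<open>The preceding lemma passes from small real parts in L^1 to small polynomials in L^1, so
  fast approximation of \<open>u\<close> forces the polynomials themselves to converge almost
  everywhere. The sequence \<open>P\<close> stays in the conclusion because the uniform bound on Re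
  P dominates exp P, which lets integral identities pass to exp v.\<close>

lemma harmonic_conjugate:
  fixes u :: "real \<Rightarrow> real"
  assumes m: "u \<in> borel_measurable circ" and K: "\<And>x. \<bar>u x\<bar> \<le> K"
    and z: "(\<integral>x. u x \<partial>circ) = 0"
  obtains P :: "nat \<Rightarrow> complex poly" and C v
  where "\<And>n. poly (P n) 0 = 0" "\<And>n x. \<bar>Re (poly (P n) (cis x))\<bar> \<le> C"
    "v \<in> borel_measurable circ"
    "AE x in circ. (\<lambda>n. poly (P n) (cis x)) \<longlonglongrightarrow> v x \<and> Re (v x) = u x"
proof -
  define C where "C = 2 * (K + 1)"
  have K0: "K \<ge> 0" using K[of 0] by linarith
  \<comment> \<open>The rate \<open>(1/4)^n\<close> survives the later division by
    \<open>t = (1/2)^n\<close> as a summable rate.\<close>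
  have "\<exists>p. poly p 0 = 0 \<and> (\<forall>x. \<bar>Re (poly p (cis x))\<bar> \<le> C) \<and>
      (\<integral>x. \<bar>Re (poly p (cis x)) - u x\<bar> \<partial>circ) \<le> (1/4)^n" for n
    unfolding C_def by (rule bounded_real_poly_approx[OF m K z, of "(1/4)^n"]) (simp, blast)
  then obtain P where P: "\<And>n. poly (P n) 0 = 0" "\<And>n x. \<bar>Re (poly (P n) (cis x))\<bar> \<le> C"
      "\<And>n. (\<integral>x. \<bar>Re (poly (P n) (cis x)) - u x\<bar> \<partial>circ) \<le> (1/4)^n"
    by metis
  have iu: "integrable circ u" using K by (intro integrable_circ_bounded[OF m, of K]) auto
  define D where "D n = P (Suc n) - P n" for n
  have iP: "integrable circ (\<lambda>x. Re (poly p (cis x)))" for p using integrable_poly_cis by auto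
  have iR: "integrable circ (\<lambda>x. \<bar>Re (poly (P n) (cis x)) - u x\<bar>)" for n using iP iu by auto
  have D1: "(\<integral>x. \<bar>Re (poly (D n) (cis x))\<bar> \<partial>circ) \<le> 2 * (1/4)^n" for n
  proof -
    have "(\<integral>x. \<bar>Re (poly (D n) (cis x))\<bar> \<partial>circ)
        \<le> (\<integral>x. \<bar>Re (poly (P (Suc n)) (cis x)) - u x\<bar> + \<bar>Re (poly (P n) (cis x)) - u x\<bar> \<partial>circ)"
      by (rule integral_mono) (use iP iR in \<open>auto simp: D_def\<close>)
    also have "\<dots> = (\<integral>x. \<bar>Re (poly (P (Suc n)) (cis x)) - u x\<bar> \<partial>circ) + (\<integral>x. \<bar>Re (poly (P n) (cis x)) - u x\<bar> \<partial>circ)"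
      by (rule Bochner_Integration.integral_add) (rule iR)+
    also have "\<dots> \<le> (1/4)^Suc n + (1/4)^n" by (intro add_mono P)
    also have "\<dots> \<le> 2 * (1/4)^n" by simp
    finally show ?thesis .
  qed
  \<comment> \<open>With \<open>t = (1/2)^n\<close> both terms of the L^1 estimate are of order
    \<open>(1/2)^n\<close>; \<open>2 * C\<close> bounds the real part of a difference of two
    approximants.\<close>
  have D2: "(\<integral>x. norm (poly (D n) (cis x)) \<partial>circ) \<le> (pi + 4 * C) * (1/2)^n" for n
  proof -
    have "(\<integral>x. norm (poly (D n) (cis x)) \<partial>circ)
        \<le> pi * (1/2)^n + (2 * C / (1/2)^n) * (\<integral>x. \<bar>Re (poly (D n) (cis x))\<bar> \<partial>circ)"
    proof (rule integral_norm_poly_cis_le)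
      show "\<bar>Re (poly (D n) (cis x))\<bar> \<le> 2 * C" for x
        using P(2)[of n x] P(2)[of "Suc n" x] by (simp add: D_def)
    qed (use P in \<open>auto simp: D_def\<close>)
    also have "\<dots> \<le> pi * (1/2)^n + (2 * C / (1/2)^n) * (2 * (1/4)^n)"
      using K0 by (intro add_left_mono mult_left_mono D1) (auto simp: C_def)
    also have "(1/4::real)^n = (1/2)^n * (1/2)^n" by (simp add: power_mult_distrib[symmetric])
    finally show ?thesis by (simp add: algebra_simps)
  qed
  have s2: "AE x in circ. summable (\<lambda>n. norm (poly (D n) (cis x)))"
  proof (rule AE_summable_norm)
    show "summable (\<lambda>n. \<integral>x. norm (poly (D n) (cis x)) \<partial>circ)"
    proof (rule summable_comparison_test')
      show "summable (\<lambda>n. (pi + 4 * C) * (1/2)^n)" by (intro summable_mult summable_geometric) simp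
    qed (use D2 in \<open>simp add: integral_nonneg_AE\<close>)
  qed (rule integrable_poly_cis)
  have s1: "AE x in circ. summable (\<lambda>n. norm (Re (poly (P n) (cis x)) - u x))"
  proof (rule AE_summable_norm)
    show "summable (\<lambda>n. \<integral>x. norm (Re (poly (P n) (cis x)) - u x) \<partial>circ)"
    proof (rule summable_comparison_test')
      show "summable (\<lambda>n. (1/4)^n :: real)" by (intro summable_geometric) simp
    qed (use P(3) in \<open>simp add: integral_nonneg_AE\<close>)
  qed (use iP iu in auto)
  show thesis
  proof (rule that[of P C "\<lambda>x. lim (\<lambda>n. poly (P n) (cis x))"])
    show "(\<lambda>x. lim (\<lambda>n. poly (P n) (cis x))) \<in> borel_measurable circ"
      by (rule borel_measurable_lim_metric) measurable
    show "AE x in circ. (\<lambda>n. poly (P n) (cis x)) \<longlonglongrightarrow> lim (\<lambda>n. poly (P n) (cis x)) \<and>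
       Re (lim (\<lambda>n. poly (P n) (cis x))) = u x"
      using s1 s2
    proof eventually_elim
      case (elim x)
      have "summable (\<lambda>n. poly (D n) (cis x))" using elim(2) by (rule summable_norm_cancel)
      then have "(\<lambda>n. \<Sum>i<n. poly (D i) (cis x)) \<longlonglongrightarrow> (\<Sum>i. poly (D i) (cis x))" by (rule summable_LIMSEQ)
      moreover have "(\<Sum>i<n. poly (D i) (cis x)) = poly (P n) (cis x) - poly (P 0) (cis x)" for n
        using sum_lessThan_telescope[of "\<lambda>n. poly (P n) (cis x)" n] by (simp add: D_def)
      ultimately have "(\<lambda>n. (poly (P n) (cis x) - poly (P 0) (cis x)) + poly (P 0) (cis x))
          \<longlonglongrightarrow> (\<Sum>i. poly (D i) (cis x)) + poly (P 0) (cis x)"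
        by (intro tendsto_add tendsto_const) simp
      then have "convergent (\<lambda>n. poly (P n) (cis x))" unfolding convergent_def by (intro exI) simp
      then have l: "(\<lambda>n. poly (P n) (cis x)) \<longlonglongrightarrow> lim (\<lambda>n. poly (P n) (cis x))"
        by (simp add: convergent_LIMSEQ_iff)
      have "(\<lambda>n. Re (poly (P n) (cis x)) - u x) \<longlonglongrightarrow> 0"
        using summable_LIMSEQ_zero[OF elim(1)] by (simp add: tendsto_norm_zero_iff tendsto_rabs_zero_iff)
      then have "(\<lambda>n. Re (poly (P n) (cis x))) \<longlonglongrightarrow> u x" by (simp add: LIM_zero_iff)
      then show ?case using l LIMSEQ_unique[OF tendsto_Re[OF l]] by simp
    qed
  qed (use P in auto)
qed

section \<open>Multipliers of the Hardy space\<close>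

lemma in_L2_integrable:
  assumes E: "E \<in> lmeasurable" and g: "in_L2 E g"
  shows "integrable (lebesgue_on E) g"
proof (rule Bochner_Integration.integrable_bound)
  interpret finite_measure "lebesgue_on E" by (rule finite_measure_lebesgue_on[OF E])
  show "integrable (lebesgue_on E) (\<lambda>x. 1 + (norm (g x))\<^sup>2)"
    using g by (simp add: in_L2_def)
  show "g \<in> borel_measurable (lebesgue_on E)" using g by (simp add: in_L2_def)
  show "AE x in lebesgue_on E. norm (g x) \<le> norm (1 + (norm (g x))\<^sup>2)"
  proof (rule AE_I2)
    fix x
    have "norm (g x) \<le> 1 + (norm (g x))\<^sup>2"
      using zero_le_power2[of "norm (g x) - 1/2"] by (simp add: power2_diff algebra_simps power2_eq_square)
    then show "norm (g x) \<le> norm (1 + (norm (g x))\<^sup>2)" by simp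
  qed
qed

lemma H2_iff: "H2 g \<longleftrightarrow> in_L2 Tcirc g \<and> analytic_type g"
proof -
  have "exp (\<i> * of_nat k * of_real x) = cis x ^ k" for k :: nat and x :: real
    by (simp add: cis_conv_exp exp_of_nat_mult[symmetric] mult_ac)
  then show ?thesis
    unfolding H2_def analytic_type_def using in_L2_integrable[OF Tcirc_lmeasurable] by auto
qed

lemma norm_add_power2_le: "(norm (a + b))\<^sup>2 \<le> 2 * (norm a)\<^sup>2 + 2 * (norm b)\<^sup>2" for a b :: complex
proof -
  have "(norm (a + b))\<^sup>2 \<le> (norm a + norm b)\<^sup>2" by (intro power_mono norm_triangle_ineq) auto
  also have "\<dots> \<le> 2 * (norm a)\<^sup>2 + 2 * (norm b)\<^sup>2"
    using zero_le_power2[of "norm a - norm b"] by (simp add: power2_sum power2_diff)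
  finally show ?thesis .
qed

section \<open>Linear operations and bounded factors in L^2 and the Hardy space\<close>

lemma in_L2_add:
  assumes "in_L2 E f" "in_L2 E g"
  shows "in_L2 E (\<lambda>x. f x + g x)"
  unfolding in_L2_def
proof
  note [measurable] = assms[unfolded in_L2_def, THEN conjunct1]
  show "(\<lambda>x. f x + g x) \<in> borel_measurable (lebesgue_on E)" by measurable
  show "integrable (lebesgue_on E) (\<lambda>x. (norm (f x + g x))\<^sup>2)"
  proof (rule Bochner_Integration.integrable_bound)
    show "integrable (lebesgue_on E) (\<lambda>x. 2 * (norm (f x))\<^sup>2 + 2 * (norm (g x))\<^sup>2)"
      using assms by (auto simp: in_L2_def)
    show "AE x in lebesgue_on E. norm ((norm (f x + g x))\<^sup>2) \<le> norm (2 * (norm (f x))\<^sup>2 + 2 * (norm (g x))\<^sup>2)"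
      using norm_add_power2_le by (intro AE_I2) simp
  qed measurable
qed

lemma in_L2_mult_bounded:
  assumes k: "k \<in> borel_measurable (lebesgue_on E)" "AE x in lebesgue_on E. norm (k x) \<le> B"
    and f: "in_L2 E f"
  shows "in_L2 E (\<lambda>x. k x * f x)"
  unfolding in_L2_def
proof
  note [measurable] = f[unfolded in_L2_def, THEN conjunct1] k(1)
  show "(\<lambda>x. k x * f x) \<in> borel_measurable (lebesgue_on E)" by measurable
  show "integrable (lebesgue_on E) (\<lambda>x. (norm (k x * f x))\<^sup>2)"
  proof (rule Bochner_Integration.integrable_bound)
    show "integrable (lebesgue_on E) (\<lambda>x. B\<^sup>2 * (norm (f x))\<^sup>2)"
      using f by (auto simp: in_L2_def)
    show "AE x in lebesgue_on E. norm ((norm (k x * f x))\<^sup>2) \<le> norm (B\<^sup>2 * (norm (f x))\<^sup>2)"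
      using k(2)
    proof eventually_elim
      case (elim x)
      then have "(norm (k x))\<^sup>2 \<le> B\<^sup>2" by (intro power_mono) auto
      then show ?case by (simp add: norm_mult power_mult_distrib mult_right_mono)
    qed
  qed measurable
qed

lemma in_L2_cmult: "in_L2 E f \<Longrightarrow> in_L2 E (\<lambda>x. c * f x)"
  by (rule in_L2_mult_bounded[of _ _ "norm c"]) auto

lemma in_L2_diff:
  assumes "in_L2 E f" "in_L2 E g"
  shows "in_L2 E (\<lambda>x. f x - g x)"
  using in_L2_add[OF assms(1) in_L2_cmult[OF assms(2), of "-1"]] by simp

lemma analytic_type_add:
  assumes "analytic_type f" "analytic_type g"
  shows "analytic_type (\<lambda>x. f x + g x)"
proof -
  have i: "integrable circ f" "integrable circ g" using assms by (auto simp: analytic_type_def)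
  have ik: "integrable circ (\<lambda>x. f x * cis x ^ k)" "integrable circ (\<lambda>x. g x * cis x ^ k)" for k
    using integrable_mult_poly_cis[OF i(1), of "monom 1 k"] integrable_mult_poly_cis[OF i(2), of "monom 1 k"]
    by (simp_all add: poly_monom)
  have "(\<integral>x. (f x + g x) * cis x ^ k \<partial>circ) = (\<integral>x. f x * cis x ^ k \<partial>circ) + (\<integral>x. g x * cis x ^ k \<partial>circ)" for k
    using ik by (simp add: ring_distribs)
  then show ?thesis using assms i by (simp add: analytic_type_def)
qed

lemma analytic_type_cmult: "analytic_type f \<Longrightarrow> analytic_type (\<lambda>x. c * f x)"
  by (simp add: analytic_type_def mult.assoc)

lemma H2_add: "H2 f \<Longrightarrow> H2 g \<Longrightarrow> H2 (\<lambda>x. f x + g x)"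
  by (simp add: H2_iff in_L2_add analytic_type_add)

lemma H2_cmult: "H2 f \<Longrightarrow> H2 (\<lambda>x. c * f x)"
  by (simp add: H2_iff in_L2_cmult analytic_type_cmult)

lemma H2_diff: "H2 f \<Longrightarrow> H2 g \<Longrightarrow> H2 (\<lambda>x. f x - g x)"
  using H2_add[of f "\<lambda>x. -1 * g x"] H2_cmult[of g "-1"] by simp

lemma H2_1: "H2 (\<lambda>x. 1)"
  unfolding H2_iff in_L2_def using analytic_type_1 by (auto intro: integrable_circ_bounded[of _ 1])

text \<open>These are the boundary values of bounded analytic functions, described by their action
  on \<open>H2\<close>. In this form products of multipliers are multipliers at once, and applying
  one to the constant 1 recovers membership in \<open>H2\<close>.\<close>

definition multiplier :: "(real \<Rightarrow> complex) \<Rightarrow> bool" where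
  "multiplier k \<longleftrightarrow> k \<in> borel_measurable circ \<and> (\<exists>B. AE x in circ. norm (k x) \<le> B) \<and>
     (\<forall>g. H2 g \<longrightarrow> H2 (\<lambda>x. k x * g x))"

lemma multiplier_const: "multiplier (\<lambda>x. c)"
  unfolding multiplier_def using H2_cmult by (auto intro: exI[of _ "norm c"])

lemma multiplier_cis: "multiplier cis"
  unfolding multiplier_def
proof (intro conjI allI impI)
  fix g assume g: "H2 g"
  have "in_L2 Tcirc (\<lambda>x. cis x * g x)"
    by (rule in_L2_mult_bounded[of _ _ 1]) (use g in \<open>auto simp: H2_iff\<close>)
  moreover have "analytic_type (\<lambda>x. cis x * g x)"
    using analytic_type_mult_cis[of g] g by (simp add: H2_iff mult.commute)
  ultimately show "H2 (\<lambda>x. cis x * g x)" by (simp add: H2_iff)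
qed (auto intro: exI[of _ 1])

lemma multiplier_add:
  assumes "multiplier k" "multiplier l"
  shows "multiplier (\<lambda>x. k x + l x)"
proof -
  obtain A B where "AE x in circ. norm (k x) \<le> A" "AE x in circ. norm (l x) \<le> B"
    using assms by (auto simp: multiplier_def)
  then have "AE x in circ. norm (k x + l x) \<le> A + B"
    by eventually_elim (auto intro: norm_triangle_mono)
  then show ?thesis
    using assms unfolding multiplier_def by (auto simp: ring_distribs intro!: H2_add)
qed

lemma multiplier_mult:
  assumes "multiplier k" "multiplier l"
  shows "multiplier (\<lambda>x. k x * l x)"
proof -
  obtain A B where AB: "AE x in circ. norm (k x) \<le> A" "AE x in circ. norm (l x) \<le> B"
    using assms by (auto simp: multiplier_def)
  have "AE x in circ. norm (k x * l x) \<le> A * B"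
    using AB
  proof eventually_elim
    case (elim x)
    then show ?case unfolding norm_mult by (intro mult_mono) (auto intro: order_trans[OF norm_ge_zero])
  qed
  then show ?thesis
    using assms unfolding multiplier_def by (auto simp: mult.assoc)
qed

text \<open>The multiplier is \<open>(1 - exp v) / z\<close> for an analytic \<open>v\<close> with \<open>v(0) = 0\<close>, so the pole cancels.
  Its real part is a large negative constant off \<open>E\<close>, at the price of a large positive one on \<open>E\<close>.\<close>

lemma approx_cnj_cis:
  assumes E: "E \<in> sets lebesgue" "E \<subseteq> Tcirc" "emeasure lebesgue E > 0" and e: "e > 0"
  obtains b where "multiplier b" "AE x in circ. x \<notin> E \<longrightarrow> norm (b x - cnj (cis x)) \<le> e"
proof -
  \<comment> \<open>Off \<open>E\<close> the error will be exp (-A). The maximum with 0 covers the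
    case e > 1.\<close>
  define A where "A = max 0 (- ln e)"
  have A: "A \<ge> 0" "exp (- A) \<le> e"
  proof -
    have "exp (- A) \<le> exp (ln e)" unfolding A_def by (subst exp_le_cancel_iff) auto
    then show "exp (- A) \<le> e" using e by simp
  qed (simp add: A_def)
  have Elm: "E \<in> lmeasurable"
    using fmeasurableI2[OF Tcirc_lmeasurable E(2,1)] .
  define m where "m = measure lebesgue E"
  have m: "m > 0"
    using E(3) by (simp add: m_def emeasure_eq_measure2[OF Elm])
  \<comment> \<open>The weight on \<open>E\<close> is chosen to make the mean vanish:
    \<open>- A\<close> contributes \<open>- 2 * pi * A\<close>, and the step contributes
    \<open>(2 * pi * A / m) * m\<close>.\<close>
  define u where "u x = - A + (2 * pi * A / m) * indicat_real E x" for x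
  have Ec: "E \<in> sets circ" using E Tcirc_sets by (simp add: sets_restrict_space_iff)
  have um: "u \<in> borel_measurable circ" unfolding u_def using Ec by measurable
  have ub: "\<bar>u x\<bar> \<le> A + 2 * pi * A / m" for x
    using A(1) m by (auto simp: u_def abs_le_iff indicator_def)
  have mE: "measure circ E = m"
    using E Tcirc_sets by (simp add: measure_restrict_space m_def)
  have iE: "integrable circ (indicat_real E)"
    by (rule integrable_circ_bounded[of _ 1]) (use Ec in \<open>auto simp: indicator_def\<close>)
  have "(\<integral>x. u x \<partial>circ) = (\<integral>x. - A \<partial>circ) + (\<integral>x. (2 * pi * A / m) * indicat_real E x \<partial>circ)"
    unfolding u_def
    by (rule Bochner_Integration.integral_add)
       (use iE in \<open>auto intro: integrable_circ_bounded[of _ "norm A"]\<close>)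
  also have "\<dots> = 0" using Ec mE m E(2) by (simp add: integral_circ_const Int_absorb2)
  finally have uz: "(\<integral>x. u x \<partial>circ) = 0" .
  obtain P C v where P: "\<And>n. poly (P n) 0 = 0" "\<And>n x. \<bar>Re (poly (P n) (cis x))\<bar> \<le> C"
    and vm: "v \<in> borel_measurable circ"
    and lim: "AE x in circ. (\<lambda>n. poly (P n) (cis x)) \<longlonglongrightarrow> v x \<and> Re (v x) = u x"
    by (rule harmonic_conjugate[OF um ub uz]) (rule that)
  note [measurable] = vm
  have ne: "norm (exp (poly (P n) (cis x))) \<le> exp C" for n x
    using P(2)[of n x] by simp
  have nv: "AE x in circ. norm (exp (v x)) \<le> exp (A + 2 * pi * A / m)"
    using lim
  proof eventually_elim
    case (elim x)
    then show ?case using ub[of x] by simp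
  qed
  \<comment> \<open>The identity holds for each polynomial \<open>P n\<close>, and the uniform bound
    on Re (P n) permits dominated convergence to exp v.\<close>
  have expv: "(\<integral>x. G x * exp (v x) \<partial>circ) = (\<integral>x. G x \<partial>circ)" if G: "analytic_type G" for G
  proof -
    have iG: "integrable circ G" using G by (simp add: analytic_type_def)
    have [measurable]: "G \<in> borel_measurable circ" using iG by simp
    have "(\<lambda>n. \<integral>x. G x * exp (poly (P n) (cis x)) \<partial>circ) \<longlonglongrightarrow> (\<integral>x. G x * exp (v x) \<partial>circ)"
    proof (rule integral_dominated_convergence[where w = "\<lambda>x. norm (G x) * exp C"])
      show "AE x in circ. (\<lambda>n. G x * exp (poly (P n) (cis x))) \<longlonglongrightarrow> G x * exp (v x)"
        using lim by eventually_elim (auto intro!: tendsto_intros)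
      show "AE x in circ. norm (G x * exp (poly (P n) (cis x))) \<le> norm (G x) * exp C" for n
        unfolding norm_mult by (intro AE_I2 mult_left_mono ne) auto
      show "integrable circ (\<lambda>x. norm (G x) * exp C)" using iG by auto
    qed measurable
    then show ?thesis using analytic_type_integral_exp[OF G P(1)] by (simp add: LIMSEQ_const_iff)
  qed
  define b where "b x = cnj (cis x) * (1 - exp (v x))" for x
  have [measurable]: "(\<lambda>x. cnj (cis x)) \<in> borel_measurable circ"
    by (intro measurable_circ continuous_intros)
  have bm: "b \<in> borel_measurable circ" unfolding b_def by measurable
  have bb: "AE x in circ. norm (b x) \<le> 1 + exp (A + 2 * pi * A / m)"
    using nv
  proof eventually_elim
    case (elim x)
    have "norm (1 - exp (v x)) \<le> norm (1::complex) + norm (exp (v x))" by (rule norm_triangle_ineq4)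
    then show ?case using elim by (simp add: b_def norm_mult del: norm_exp_eq_Re)
  qed
  show thesis
  proof (rule that[of b])
    show "multiplier b"
      unfolding multiplier_def
    proof (intro conjI allI impI exI[of _ "1 + exp (A + 2 * pi * A / m)"])
      fix g assume g: "H2 g"
      have 1: "in_L2 Tcirc (\<lambda>x. b x * g x)"
        by (rule in_L2_mult_bounded[OF bm bb]) (use g in \<open>simp add: H2_iff\<close>)
      have "(\<integral>x. b x * g x * cis x ^ k \<partial>circ) = 0" if k0: "k > 0" for k
      proof -
        \<comment> \<open>One of the \<open>k\<close> factors \<open>cis\<close> cancels the
          \<open>cnj (cis x)\<close> in \<open>b\<close>. What remains is
          \<open>G * (1 - exp v)\<close>, of integral zero because multiplying by exp v does not
          change the mean of \<open>G\<close>.\<close>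
        obtain j where k: "k = Suc j" using k0 by (cases k) auto
        define G where "G x = g x * cis x ^ j" for x
        have G: "analytic_type G"
          unfolding G_def by (rule analytic_type_mult_cis_power) (use g in \<open>simp add: H2_iff\<close>)
        have iG: "integrable circ G" using G by (simp add: analytic_type_def)
        have "b x * g x * cis x ^ k = G x - G x * exp (v x)" for x
        proof -
          have "b x * g x * cis x ^ k = (cis x * cnj (cis x)) * (1 - exp (v x)) * G x"
            by (simp add: b_def G_def k mult_ac)
          also have "cis x * cnj (cis x) = 1" by (simp add: complex_norm_square[symmetric])
          finally show ?thesis by (simp add: algebra_simps)
        qed
        moreover have "integrable circ (\<lambda>x. G x * exp (v x))"
          by (rule integrable_mult_bounded[OF iG _ nv]) measurable
        ultimately show ?thesis using iG expv[OF G] by simp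
      qed
      then show "H2 (\<lambda>x. b x * g x)"
        using 1 in_L2_integrable[OF Tcirc_lmeasurable 1] by (simp add: H2_iff analytic_type_def)
    qed (use bm bb in auto)
    show "AE x in circ. x \<notin> E \<longrightarrow> norm (b x - cnj (cis x)) \<le> e"
      using lim
    proof eventually_elim
      case (elim x)
      show ?case
      proof
        assume "x \<notin> E"
        then have "Re (v x) = - A" using elim by (simp add: u_def)
        moreover have "norm (b x - cnj (cis x)) = exp (Re (v x))"
          by (simp add: b_def algebra_simps norm_mult)
        ultimately show "norm (b x - cnj (cis x)) \<le> e" using A by simp
      qed
    qed
  qed
qed

text \<open>The size of \<open>k\<close> on \<open>E\<close> is left free and may grow as
  \<open>e\<close> shrinks.\<close>

definition multiplier_approximable :: "real set \<Rightarrow> (complex \<Rightarrow> complex) \<Rightarrow> bool" where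
  "multiplier_approximable E \<psi> \<longleftrightarrow>
     (\<forall>e>0. \<exists>k. multiplier k \<and> (AE x in circ. x \<notin> E \<longrightarrow> norm (k x - \<psi> (cis x)) \<le> e))"

lemma multiplier_approximable_const: "multiplier_approximable E (\<lambda>z. c)"
  unfolding multiplier_approximable_def
  by (intro allI impI exI[of _ "\<lambda>x. c"] conjI multiplier_const) simp

lemma multiplier_approximable_id: "multiplier_approximable E (\<lambda>z. z)"
  unfolding multiplier_approximable_def
  by (intro allI impI exI[of _ cis] conjI multiplier_cis) simp

lemma multiplier_approximable_add:
  assumes "multiplier_approximable E f" "multiplier_approximable E g"
  shows "multiplier_approximable E (\<lambda>z. f z + g z)"
  unfolding multiplier_approximable_def
proof (intro allI impI)
  fix e :: real assume "e > 0"
  then have e: "e/2 > 0" by simp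
  obtain k l where k: "multiplier k" "AE x in circ. x \<notin> E \<longrightarrow> norm (k x - f (cis x)) \<le> e/2"
    and l: "multiplier l" "AE x in circ. x \<notin> E \<longrightarrow> norm (l x - g (cis x)) \<le> e/2"
    using assms[unfolded multiplier_approximable_def, rule_format, OF e] by blast
  have "AE x in circ. x \<notin> E \<longrightarrow> norm (k x + l x - (f (cis x) + g (cis x))) \<le> e"
    using k(2) l(2)
  proof eventually_elim
    case (elim x)
    show ?case
    proof
      assume "x \<notin> E"
      then show "norm (k x + l x - (f (cis x) + g (cis x))) \<le> e"
        using elim norm_diff_triangle_ineq[of "k x" "l x" "f (cis x)" "g (cis x)"] by linarith
    qed
  qed
  then show "\<exists>k. multiplier k \<and> (AE x in circ. x \<notin> E \<longrightarrow> norm (k x - (f (cis x) + g (cis x))) \<le> e)"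
    using multiplier_add[OF k(1) l(1)] by blast
qed

lemma circle_bounded:
  fixes f :: "complex \<Rightarrow> 'a::real_normed_vector"
  assumes "continuous_on (sphere 0 1) f"
  obtains B where "B > 0" "\<And>x. norm (f (cis x)) \<le> B"
proof -
  have "compact (f ` sphere 0 1)" by (intro compact_continuous_image assms) auto
  then obtain B where "B > 0" "\<forall>w\<in>f ` sphere 0 1. norm w \<le> B"
    using compact_imp_bounded bounded_pos by metis
  then show thesis using that by auto
qed

lemma multiplier_approximable_mult:
  assumes "multiplier_approximable E f" "multiplier_approximable E g"
    and c: "continuous_on (sphere 0 1) f" "continuous_on (sphere 0 1) g"
  shows "multiplier_approximable E (\<lambda>z. f z * g z)"
  unfolding multiplier_approximable_def
proof (intro allI impI)
  fix e :: real assume e: "e > 0"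
  obtain A B where AB: "A > 0" "\<And>x. norm (f (cis x)) \<le> A" "B > 0" "\<And>x. norm (g (cis x)) \<le> B"
    by (rule circle_bounded[OF c(1)], rule circle_bounded[OF c(2)]) (rule that)
  \<comment> \<open>Since d is at most 1, \<open>l\<close> is bounded by \<open>B + 1\<close> off
    \<open>E\<close>, and the product error is at most \<open>d * (B + 1) + A * d\<close>.\<close>
  define d where "d = min 1 (e / (A + B + 1))"
  have d: "d > 0" "d \<le> 1" "d * (A + B + 1) \<le> e"
  proof -
    show "d > 0" "d \<le> 1" using AB e by (auto simp: d_def)
    have "d \<le> e / (A + B + 1)" by (simp add: d_def)
    then show "d * (A + B + 1) \<le> e" using AB by (subst (asm) pos_le_divide_eq) auto
  qed
  obtain k l where k: "multiplier k" "AE x in circ. x \<notin> E \<longrightarrow> norm (k x - f (cis x)) \<le> d"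
    and l: "multiplier l" "AE x in circ. x \<notin> E \<longrightarrow> norm (l x - g (cis x)) \<le> d"
    using assms(1,2)[unfolded multiplier_approximable_def, rule_format, OF d(1)] by blast
  have "AE x in circ. x \<notin> E \<longrightarrow> norm (k x * l x - f (cis x) * g (cis x)) \<le> e"
    using k(2) l(2)
  proof eventually_elim
    case (elim x)
    show ?case
    proof
      assume "x \<notin> E"
      then have kl: "norm (k x - f (cis x)) \<le> d" "norm (l x - g (cis x)) \<le> d" using elim by auto
      have nl: "norm (l x) \<le> B + 1"
        using norm_triangle_ineq2[of "l x" "g (cis x)"] kl(2) AB(4)[of x] d(2) by linarith
      have "k x * l x - f (cis x) * g (cis x) = (k x - f (cis x)) * l x + f (cis x) * (l x - g (cis x))"
        by (simp add: algebra_simps)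
      also have "norm \<dots> \<le> norm (k x - f (cis x)) * norm (l x) + norm (f (cis x)) * norm (l x - g (cis x))"
        by (metis norm_mult norm_triangle_ineq)
      also have "\<dots> \<le> d * (B + 1) + A * d"
        using kl nl AB d by (intro add_mono mult_mono) auto
      also have "\<dots> \<le> e" using d(3) by (simp add: algebra_simps)
      finally show "norm (k x * l x - f (cis x) * g (cis x)) \<le> e" .
    qed
  qed
  then show "\<exists>k. multiplier k \<and> (AE x in circ. x \<notin> E \<longrightarrow> norm (k x - f (cis x) * g (cis x)) \<le> e)"
    using multiplier_mult[OF k(1) l(1)] by blast
qed

lemma multiplier_approximable_uniform:
  assumes "\<And>e. e > 0 \<Longrightarrow> \<exists>g. multiplier_approximable E g \<and> (\<forall>z\<in>sphere 0 1. norm (f z - g z) \<le> e)"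
  shows "multiplier_approximable E f"
  unfolding multiplier_approximable_def
proof (intro allI impI)
  fix e :: real assume "e > 0"
  then have e: "e/2 > 0" by simp
  obtain g where g: "multiplier_approximable E g" "\<forall>z\<in>sphere 0 1. norm (f z - g z) \<le> e/2"
    using assms[OF e] by blast
  obtain k where k: "multiplier k" "AE x in circ. x \<notin> E \<longrightarrow> norm (k x - g (cis x)) \<le> e/2"
    using g(1)[unfolded multiplier_approximable_def, rule_format, OF e] by blast
  have "AE x in circ. x \<notin> E \<longrightarrow> norm (k x - f (cis x)) \<le> e"
    using k(2)
  proof eventually_elim
    case (elim x)
    have "norm (k x - f (cis x)) \<le> norm (k x - g (cis x)) + norm (f (cis x) - g (cis x))"
      using norm_triangle_ineq4[of "k x - g (cis x)" "f (cis x) - g (cis x)"] by (simp only: diff_diff_eq2 diff_add_cancel)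
    moreover have "norm (f (cis x) - g (cis x)) \<le> e/2" using g(2) sphere_cis by blast
    ultimately show ?case using elim by auto
  qed
  then show "\<exists>k. multiplier k \<and> (AE x in circ. x \<notin> E \<longrightarrow> norm (k x - f (cis x)) \<le> e)"
    using k(1) by blast
qed

text \<open>Once the conjugate coordinate is approximable, so are \<open>Re\<close> and
  \<open>Im\<close>, which separate points. The real Stone-Weierstrass theorem then gives all real
  continuous functions, and real and imaginary parts are recombined at the end.\<close>

lemma multiplier_approximable_continuous:
  assumes E: "E \<in> sets lebesgue" "E \<subseteq> Tcirc" "emeasure lebesgue E > 0"
    and \<psi>: "continuous_on (sphere 0 1) \<psi>"
  shows "multiplier_approximable E \<psi>"
proof -
  \<comment> \<open>Continuity is carried along because closure under products needs factors bounded
    on the circle.\<close>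
  let ?Q = "\<lambda>f. continuous_on (sphere 0 1) f \<and> multiplier_approximable E (\<lambda>z. complex_of_real (f z))"
  have cnj: "multiplier_approximable E cnj"
    unfolding multiplier_approximable_def using approx_cnj_cis[OF E] by metis
  have re: "?Q Re"
  proof
    have "multiplier_approximable E (\<lambda>z. (1/2) * (z + cnj z))"
      by (intro multiplier_approximable_mult multiplier_approximable_add multiplier_approximable_const
          multiplier_approximable_id cnj continuous_intros)
    then show "multiplier_approximable E (\<lambda>z. complex_of_real (Re z))"
      by (simp add: complex_add_cnj)
  qed (intro continuous_intros)
  have im: "?Q Im"
  proof
    have "multiplier_approximable E (\<lambda>z. (- \<i>/2) * (z + (-1) * cnj z))"
      by (intro multiplier_approximable_mult multiplier_approximable_add multiplier_approximable_const
          multiplier_approximable_id cnj continuous_intros)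
    moreover have "(- \<i>/2) * (z + (-1) * cnj z) = complex_of_real (Im z)" for z
      by (simp add: complex_eq_iff)
    ultimately show "multiplier_approximable E (\<lambda>z. complex_of_real (Im z))" by simp
  qed (intro continuous_intros)
  have real: "multiplier_approximable E (\<lambda>z. complex_of_real (f z))"
    if f: "continuous_on (sphere 0 1) f" for f
  proof (rule multiplier_approximable_uniform)
    fix e :: real assume e: "e > 0"
    have "\<exists>g. ?Q g \<and> (\<forall>z\<in>sphere 0 1. \<bar>f z - g z\<bar> < e)"
    proof (rule Stone_Weierstrass_HOL)
      show "?Q (\<lambda>x. c)" for c using multiplier_approximable_const by auto
      show "?Q (\<lambda>x. f x + g x)" if "?Q f \<and> ?Q g" for f g
        using that by (auto intro!: continuous_intros multiplier_approximable_add)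
      show "?Q (\<lambda>x. f x * g x)" if "?Q f \<and> ?Q g" for f g
        using that by (auto intro!: continuous_intros multiplier_approximable_mult)
      show "\<exists>f. ?Q f \<and> f x \<noteq> f y" if "x \<in> sphere 0 1 \<and> y \<in> sphere 0 1 \<and> x \<noteq> y" for x y
        using re im that complex_eqI by blast
    qed (use f e in auto)
    then obtain g where "?Q g" "\<forall>z\<in>sphere 0 1. \<bar>f z - g z\<bar> < e" by blast
    then show "\<exists>g. multiplier_approximable E g \<and> (\<forall>z\<in>sphere 0 1. norm (complex_of_real (f z) - g z) \<le> e)"
      by (intro exI[of _ "\<lambda>z. complex_of_real (g z)"])
         (auto simp flip: of_real_diff intro: less_imp_le)
  qed
  have "multiplier_approximable E (\<lambda>z. complex_of_real (Re (\<psi> z)) + \<i> * complex_of_real (Im (\<psi> z)))"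
    by (intro multiplier_approximable_add multiplier_approximable_mult multiplier_approximable_const real
        continuous_intros \<psi>)
  then show ?thesis by (simp add: complex_eq[symmetric])
qed

section \<open>Variational inequality\<close>

lemma lebesgue_on_circ:
  assumes "A \<in> sets lebesgue" "A \<subseteq> Tcirc"
  shows "lebesgue_on A = restrict_space circ A"
  using assms Tcirc_sets by (subst restrict_restrict_space) (auto simp: Int_absorb1)

lemma sets_circ: "A \<in> sets lebesgue \<Longrightarrow> A \<subseteq> Tcirc \<Longrightarrow> A \<in> sets circ"
  using Tcirc_sets by (simp add: sets_restrict_space_iff)

lemma
  fixes f :: "real \<Rightarrow> 'a::{banach, second_countable_topology}"
  assumes "A \<in> sets lebesgue" "A \<subseteq> Tcirc"
  shows integral_lebesgue_on_circ:
      "integral\<^sup>L (lebesgue_on A) f = (\<integral>x. indicator A x *\<^sub>R f x \<partial>circ)"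
    and integrable_lebesgue_on_circ:
      "integrable (lebesgue_on A) f \<longleftrightarrow> integrable circ (\<lambda>x. indicator A x *\<^sub>R f x)"
  unfolding lebesgue_on_circ[OF assms]
  using sets_circ[OF assms] assms
  by (auto simp: integral_restrict_space integrable_restrict_space Int_absorb2)

lemma AE_lebesgue_on_circ:
  assumes "A \<in> sets lebesgue" "A \<subseteq> Tcirc"
  shows "(AE x in lebesgue_on A. P x) \<longleftrightarrow> (AE x in circ. x \<in> A \<longrightarrow> P x)"
  unfolding lebesgue_on_circ[OF assms]
  using sets_circ[OF assms] assms by (subst AE_restrict_space_iff) (auto simp: Int_absorb2)

lemma in_L2_subset:
  assumes A: "A \<in> sets lebesgue" "A \<subseteq> Tcirc" and g: "in_L2 Tcirc g"
  shows "in_L2 A g"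
  unfolding in_L2_def
proof
  show "g \<in> borel_measurable (lebesgue_on A)"
    using g unfolding lebesgue_on_circ[OF A] in_L2_def by (auto intro: measurable_restrict_space1)
  show "integrable (lebesgue_on A) (\<lambda>x. (norm (g x))\<^sup>2)"
    unfolding integrable_lebesgue_on_circ[OF A]
    using g sets_circ[OF A] by (intro integrable_mult_indicator) (auto simp: in_L2_def)
qed

lemma integrable_mult_cnj_L2:
  assumes "in_L2 E f" "in_L2 E g"
  shows "integrable (lebesgue_on E) (\<lambda>x. f x * cnj (g x))"
proof (rule Bochner_Integration.integrable_bound)
  note [measurable] = assms[unfolded in_L2_def, THEN conjunct1]
  have [measurable]: "cnj \<in> borel_measurable borel"
    by (intro borel_measurable_continuous_onI continuous_intros)
  show "integrable (lebesgue_on E) (\<lambda>x. (norm (f x))\<^sup>2 + (norm (g x))\<^sup>2)"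
    using assms by (auto simp: in_L2_def)
  show "(\<lambda>x. f x * cnj (g x)) \<in> borel_measurable (lebesgue_on E)" by measurable
  show "AE x in lebesgue_on E. norm (f x * cnj (g x)) \<le> norm ((norm (f x))\<^sup>2 + (norm (g x))\<^sup>2)"
  proof (rule AE_I2)
    fix x
    have "norm (f x) * norm (g x) \<le> (norm (f x))\<^sup>2 + (norm (g x))\<^sup>2"
    proof -
      have "2 * (norm (f x) * norm (g x)) \<le> (norm (f x))\<^sup>2 + (norm (g x))\<^sup>2"
        using zero_le_power2[of "norm (f x) - norm (g x)"] by (simp add: power2_diff)
      moreover have "0 \<le> norm (f x) * norm (g x)" by simp
      ultimately show ?thesis by linarith
    qed
    then show "norm (f x * cnj (g x)) \<le> norm ((norm (f x))\<^sup>2 + (norm (g x))\<^sup>2)" by (simp add: norm_mult)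
  qed
qed

lemma L2norm_le_iff:
  "L2norm E f \<le> L2norm E g \<longleftrightarrow>
    (\<integral>x. (norm (f x))\<^sup>2 \<partial>lebesgue_on E) \<le> (\<integral>x. (norm (g x))\<^sup>2 \<partial>lebesgue_on E)"
  by (simp add: L2norm_def divide_le_cancel)

lemma L2norm_tendsto_0_iff:
  "(\<lambda>n. L2norm E (f n)) \<longlonglongrightarrow> 0 \<longleftrightarrow> (\<lambda>n. \<integral>x. (norm (f n x))\<^sup>2 \<partial>lebesgue_on E) \<longlonglongrightarrow> 0"
proof
  assume "(\<lambda>n. L2norm E (f n)) \<longlonglongrightarrow> 0"
  then have "(\<lambda>n. 2 * pi * (L2norm E (f n))\<^sup>2) \<longlonglongrightarrow> 2 * pi * 0\<^sup>2" by (intro tendsto_intros)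
  then show "(\<lambda>n. \<integral>x. (norm (f n x))\<^sup>2 \<partial>lebesgue_on E) \<longlonglongrightarrow> 0"
    by (simp add: L2norm_def)
next
  assume "(\<lambda>n. \<integral>x. (norm (f n x))\<^sup>2 \<partial>lebesgue_on E) \<longlonglongrightarrow> 0"
  then have "(\<lambda>n. L2norm E (f n)) \<longlonglongrightarrow> sqrt (1 / (2*pi) * 0)"
    unfolding L2norm_def by (intro tendsto_intros)
  then show "(\<lambda>n. L2norm E (f n)) \<longlonglongrightarrow> 0" by simp
qed

lemma BEP_adm_circ:
  assumes "I \<in> sets lebesgue"
  shows "BEP_adm (Tcirc - I) g \<longleftrightarrow> H2 g \<and> (AE x in circ. x \<notin> I \<longrightarrow> norm (g x) \<le> 1)"
proof -
  have "(AE x in circ. x \<in> Tcirc - I \<longrightarrow> norm (g x) \<le> 1) \<longleftrightarrow> (AE x in circ. x \<notin> I \<longrightarrow> norm (g x) \<le> 1)"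
    by (intro AE_cong) simp
  then show ?thesis
    using assms Tcirc_sets unfolding BEP_adm_def by (subst AE_lebesgue_on_circ) auto
qed

section \<open>First-order conditions for the extremal problem\<close>

lemma nonpos_if_le_linear:
  fixes c B t0 :: real
  assumes "t0 > 0" and "\<And>t. 0 < t \<Longrightarrow> t \<le> t0 \<Longrightarrow> c \<le> t * B"
  shows "c \<le> 0"
proof (rule tendsto_lowerbound)
  have "((\<lambda>t. t * B) \<longlongrightarrow> 0 * B) (at_right 0)" by (intro tendsto_intros)
  then show "((\<lambda>t. t * B) \<longlongrightarrow> 0) (at_right 0)" by simp
  show "\<forall>\<^sub>F t in at_right 0. c \<le> t * B"
    unfolding eventually_at_right_field using assms by (intro exI[of _ t0]) auto
qed simp

text \<open>Expanding the squared distance along \<open>g0 + t * h\<close>, minimality bounds twice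
  the inner product by \<open>t\<close> times a constant, and \<open>t\<close> tends to 0. The
  direction \<open>h\<close> need only stay admissible for short times, which later allows a step
  length depending on the size of \<open>h\<close>.\<close>

lemma BEP_sol_variation:
  assumes I: "I \<in> sets lebesgue" "I \<subseteq> Tcirc" and f: "in_L2 I f" and sol: "BEP_sol I f g0"
    and h: "H2 h" and t0: "t0 > 0"
    and adm: "\<And>t. 0 < t \<Longrightarrow> t \<le> t0 \<Longrightarrow> BEP_adm (Tcirc - I) (\<lambda>x. g0 x + of_real t * h x)"
  shows "Re (\<integral>x. (f x - g0 x) * cnj (h x) \<partial>lebesgue_on I) \<le> 0"
proof -
  let ?M = "lebesgue_on I"
  define D where "D x = f x - g0 x" for x
  have g0: "in_L2 I g0" and hL: "in_L2 I h"
    using sol h I in_L2_subset by (auto simp: BEP_sol_def BEP_adm_def H2_def)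
  have DL: "in_L2 I D" unfolding D_def by (rule in_L2_diff[OF f g0])
  let ?B = "\<integral>x. (norm (h x))\<^sup>2 \<partial>?M"
  have "2 * Re (\<integral>x. D x * cnj (h x) \<partial>?M) \<le> t * ?B" if t: "0 < t" "t \<le> t0" for t
  proof -
    have iDh: "integrable ?M (\<lambda>x. D x * cnj (h x))" by (rule integrable_mult_cnj_L2[OF DL hL])
    have iD: "integrable ?M (\<lambda>x. (norm (D x))\<^sup>2)" and ih: "integrable ?M (\<lambda>x. (norm (h x))\<^sup>2)"
      using DL hL by (auto simp: in_L2_def)
    have pw: "(norm (f x - (g0 x + of_real t * h x)))\<^sup>2
        = (norm (D x))\<^sup>2 - (2 * t) * Re (D x * cnj (h x)) + t\<^sup>2 * (norm (h x))\<^sup>2" for x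
      unfolding cmod_power2 D_def by (simp add: power2_eq_square algebra_simps)
    have "(\<integral>x. (norm (D x))\<^sup>2 \<partial>?M) \<le> (\<integral>x. (norm (f x - (g0 x + of_real t * h x)))\<^sup>2 \<partial>?M)"
      using sol adm[OF t] unfolding BEP_sol_def L2norm_le_iff D_def by blast
    also have "\<dots> = (\<integral>x. (norm (D x))\<^sup>2 \<partial>?M) - (2 * t) * (\<integral>x. Re (D x * cnj (h x)) \<partial>?M) + t\<^sup>2 * ?B"
      unfolding pw using iDh iD ih
      by (simp only: Bochner_Integration.integral_add Bochner_Integration.integral_diff
          Bochner_Integration.integrable_diff integrable_mult_right integral_mult_right_zero integrable_Re)
    finally have "t * (2 * Re (\<integral>x. D x * cnj (h x) \<partial>?M)) \<le> t * (t * ?B)"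
      unfolding integral_Re[OF iDh] by (simp add: power2_eq_square algebra_simps)
    then show ?thesis using t by (simp add: mult_le_cancel_left_pos)
  qed
  then have "2 * Re (\<integral>x. D x * cnj (h x) \<partial>?M) \<le> 0" by (rule nonpos_if_le_linear[OF t0])
  then show ?thesis by (simp add: D_def)
qed

lemma BEP_adm_convex:
  assumes I: "I \<in> sets lebesgue" and g: "BEP_adm (Tcirc - I) g" and h: "BEP_adm (Tcirc - I) h"
    and t: "0 \<le> t" "t \<le> 1"
  shows "BEP_adm (Tcirc - I) (\<lambda>x. g x + of_real t * (h x - g x))"
proof -
  have "AE x in circ. x \<notin> I \<longrightarrow> norm (g x) \<le> 1" "AE x in circ. x \<notin> I \<longrightarrow> norm (h x) \<le> 1"
    using g h by (auto simp: BEP_adm_circ[OF I])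
  then have "AE x in circ. x \<notin> I \<longrightarrow> norm (g x + of_real t * (h x - g x)) \<le> 1"
  proof eventually_elim
    case (elim x)
    show ?case
    proof
      assume "x \<notin> I"
      have "g x + of_real t * (h x - g x) = of_real (1 - t) * g x + of_real t * h x"
        by (simp add: algebra_simps)
      also have "norm \<dots> \<le> norm (of_real (1 - t) * g x) + norm (of_real t * h x)" by (rule norm_triangle_ineq)
      also have "\<dots> = (1 - t) * norm (g x) + t * norm (h x)"
        using t by (simp only: norm_mult norm_of_real)
      also have "\<dots> \<le> (1 - t) * 1 + t * 1"
        using t elim \<open>x \<notin> I\<close> by (intro add_mono mult_left_mono) auto
      finally show "norm (g x + of_real t * (h x - g x)) \<le> 1" by simp
    qed
  qed
  then show ?thesis
    using g h by (auto simp: BEP_adm_circ[OF I] intro!: H2_add H2_cmult H2_diff)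
qed

text \<open>Each solution is a competitor for the other datum. Adding the two variational
  inequalities suffices, since |f' - f|^2 plus twice their integrands exceeds |g' - g|^2 by exactly
  |(f' - f) - (g' - g)|^2.\<close>

lemma BEP_sol_nonexpansive:
  assumes I: "I \<in> sets lebesgue" "I \<subseteq> Tcirc"
    and f: "in_L2 I f" "BEP_sol I f g" and f': "in_L2 I f'" "BEP_sol I f' g'"
  shows "(\<integral>x. (norm (g' x - g x))\<^sup>2 \<partial>lebesgue_on I) \<le> (\<integral>x. (norm (f' x - f x))\<^sup>2 \<partial>lebesgue_on I)"
proof -
  let ?M = "lebesgue_on I"
  have adm: "BEP_adm (Tcirc - I) g" "BEP_adm (Tcirc - I) g'" using f f' by (auto simp: BEP_sol_def)
  then have H: "H2 g" "H2 g'" by (auto simp: BEP_adm_def)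
  then have gL: "in_L2 I g" "in_L2 I g'" using in_L2_subset[OF I] by (auto simp: H2_def)
  have 1: "Re (\<integral>x. (f x - g x) * cnj (g' x - g x) \<partial>?M) \<le> 0"
    by (rule BEP_sol_variation[OF I f H2_diff[OF H(2,1)], of 1]) (use BEP_adm_convex[OF I(1) adm] in auto)
  have 2: "Re (\<integral>x. (f' x - g' x) * cnj (g x - g' x) \<partial>?M) \<le> 0"
    by (rule BEP_sol_variation[OF I f' H2_diff[OF H], of 1]) (use BEP_adm_convex[OF I(1) adm(2,1)] in auto)
  let ?R1 = "\<lambda>x. Re ((f x - g x) * cnj (g' x - g x))" and ?R2 = "\<lambda>x. Re ((f' x - g' x) * cnj (g x - g' x))"
  have i1: "integrable ?M (\<lambda>x. (f x - g x) * cnj (g' x - g x))"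
    by (intro integrable_mult_cnj_L2 in_L2_diff f gL)
  have i2: "integrable ?M (\<lambda>x. (f' x - g' x) * cnj (g x - g' x))"
    by (intro integrable_mult_cnj_L2 in_L2_diff f' gL)
  have iL: "integrable ?M (\<lambda>x. (norm (g' x - g x))\<^sup>2)" "integrable ?M (\<lambda>x. (norm (f' x - f x))\<^sup>2)"
    using in_L2_diff[OF gL(2,1)] in_L2_diff[OF f'(1) f(1)] by (auto simp: in_L2_def)
  have iR: "integrable ?M ?R1" "integrable ?M ?R2" using integrable_Re[OF i1] integrable_Re[OF i2] .
  have pw: "(norm (g' x - g x))\<^sup>2 \<le> (norm (f' x - f x))\<^sup>2 + 2 * (?R1 x + ?R2 x)" for x
  proof -
    have "(norm (f' x - f x))\<^sup>2 + 2 * (?R1 x + ?R2 x) - (norm (g' x - g x))\<^sup>2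
        = (norm ((f' x - f x) - (g' x - g x)))\<^sup>2"
      unfolding cmod_power2 by (simp add: power2_eq_square algebra_simps)
    then show ?thesis by (smt (verit) zero_le_power2)
  qed
  have "(\<integral>x. (norm (g' x - g x))\<^sup>2 \<partial>?M) \<le> (\<integral>x. (norm (f' x - f x))\<^sup>2 + 2 * (?R1 x + ?R2 x) \<partial>?M)"
    by (intro integral_mono pw iL Bochner_Integration.integrable_add integrable_mult_right iR)
  also have "\<dots> = (\<integral>x. (norm (f' x - f x))\<^sup>2 \<partial>?M) + 2 * ((\<integral>x. ?R1 x \<partial>?M) + (\<integral>x. ?R2 x \<partial>?M))"
    using iL iR by (simp only: Bochner_Integration.integral_add Bochner_Integration.integrable_add
        integrable_mult_right integral_mult_right_zero)
  also have "\<dots> \<le> (\<integral>x. (norm (f' x - f x))\<^sup>2 \<partial>?M)"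
    using add_nonpos_nonpos[OF 1 2] unfolding integral_Re[OF i1] integral_Re[OF i2] by simp
  finally show ?thesis .
qed

text \<open>Truncating at height \<open>m\<close> reduces the claim to bounded functions, for which
  the almost everywhere approximation is dominated.\<close>

lemma L1_continuous_approx:
  fixes \<phi> :: "real \<Rightarrow> complex"
  assumes i: "integrable circ \<phi>" and e: "e > 0"
  obtains H where "continuous_on (sphere 0 1) H" "(\<integral>x. norm (\<phi> x - H (cis x)) \<partial>circ) < e"
proof -
  have [measurable]: "\<phi> \<in> borel_measurable circ" using i by simp
  define T where "T m x = (if norm (\<phi> x) \<le> real m then \<phi> x else 0)" for m x
  have Tm [measurable]: "T m \<in> borel_measurable circ" for m unfolding T_def by measurable
  have Tb: "norm (T m x) \<le> real m" for m x by (simp add: T_def)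
  have iT: "integrable circ (T m)" for m
    using Tb by (intro integrable_circ_bounded[of _ "real m"]) auto
  have "(\<lambda>m. \<integral>x. norm (\<phi> x - T m x) \<partial>circ) \<longlonglongrightarrow> (\<integral>x. 0 \<partial>circ)"
  proof (rule integral_dominated_convergence[where w = "\<lambda>x. norm (\<phi> x)"])
    show "AE x in circ. (\<lambda>m. norm (\<phi> x - T m x)) \<longlonglongrightarrow> 0"
    proof (rule AE_I2)
      fix x
      obtain m0 :: nat where m0: "norm (\<phi> x) \<le> real m0" using real_arch_simple by blast
      have "eventually (\<lambda>m. norm (\<phi> x - T m x) = 0) sequentially"
        unfolding eventually_sequentially using m0 by (intro exI[of _ m0]) (auto simp: T_def)
      then show "(\<lambda>m. norm (\<phi> x - T m x)) \<longlonglongrightarrow> 0" by (rule tendsto_eventually)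
    qed
    show "integrable circ (\<lambda>x. norm (\<phi> x))" using i by simp
    show "AE x in circ. norm (norm (\<phi> x - T m x)) \<le> norm (\<phi> x)" for m
      by (rule AE_I2) (simp add: T_def)
  qed measurable
  then have "(\<lambda>m. \<integral>x. norm (\<phi> x - T m x) \<partial>circ) \<longlonglongrightarrow> 0" by simp
  then obtain m where m: "(\<integral>x. norm (\<phi> x - T m x) \<partial>circ) < e/2"
    using order_tendstoD(2)[of _ 0 sequentially "e/2"] e eventually_happens by fastforce
  obtain H where H: "\<And>n. continuous_on (sphere 0 1) (H n)"
      "\<And>n z. z \<in> sphere 0 1 \<Longrightarrow> norm (H n z) \<le> real m"
      "AE x in circ. (\<lambda>n. H n (cis x)) \<longlonglongrightarrow> T m x"
    by (rule bounded_continuous_approx[OF Tm Tb, of m]) (rule that)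
  have [measurable]: "(\<lambda>x. H n (cis x)) \<in> borel_measurable circ" for n
    by (rule continuous_circle_measurable[OF H(1)])
  have iH: "integrable circ (\<lambda>x. H n (cis x))" for n
    using H(2)[OF sphere_cis] by (intro integrable_circ_bounded[of _ "real m"]) auto
  have "(\<lambda>n. \<integral>x. norm (T m x - H n (cis x)) \<partial>circ) \<longlonglongrightarrow> (\<integral>x. 0 \<partial>circ)"
  proof (rule integral_dominated_convergence[where w = "\<lambda>x. 2 * real m"])
    show "AE x in circ. (\<lambda>n. norm (T m x - H n (cis x))) \<longlonglongrightarrow> 0"
      using H(3)
    proof eventually_elim
      case (elim x)
      have "(\<lambda>n. norm (T m x - H n (cis x))) \<longlonglongrightarrow> norm (T m x - T m x)"
        by (intro tendsto_intros elim)
      then show ?case by simp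
    qed
    show "AE x in circ. norm (norm (T m x - H n (cis x))) \<le> 2 * real m" for n
    proof (rule AE_I2)
      fix x show "norm (norm (T m x - H n (cis x))) \<le> 2 * real m"
        using norm_triangle_ineq4[of "T m x" "H n (cis x)"] Tb[of m x] H(2)[OF sphere_cis, of n x] by simp
    qed
    show "integrable circ (\<lambda>x. 2 * real m)" by (rule integrable_circ_bounded[of _ "2 * real m"]) auto
  qed measurable
  then have "(\<lambda>n. \<integral>x. norm (T m x - H n (cis x)) \<partial>circ) \<longlonglongrightarrow> 0" by simp
  then obtain n where n: "(\<integral>x. norm (T m x - H n (cis x)) \<partial>circ) < e/2"
    using order_tendstoD(2)[of _ 0 sequentially "e/2"] e eventually_happens by fastforce
  show thesis
  proof (rule that[OF H(1)])
    have "(\<integral>x. norm (\<phi> x - H n (cis x)) \<partial>circ) \<le> (\<integral>x. norm (\<phi> x - T m x) + norm (T m x - H n (cis x)) \<partial>circ)"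
    proof (rule integral_mono)
      fix x show "norm (\<phi> x - H n (cis x)) \<le> norm (\<phi> x - T m x) + norm (T m x - H n (cis x))"
        using norm_triangle_ineq[of "\<phi> x - T m x" "T m x - H n (cis x)"] by simp
    qed (use i iT iH in auto)
    also have "\<dots> = (\<integral>x. norm (\<phi> x - T m x) \<partial>circ) + (\<integral>x. norm (T m x - H n (cis x)) \<partial>circ)"
      using i iT iH by (intro Bochner_Integration.integral_add) auto
    also have "\<dots> < e" using m n by simp
    finally show "(\<integral>x. norm (\<phi> x - H n (cis x)) \<partial>circ) < e" .
  qed
qed

section \<open>Weak convergence and saturation of the constraint\<close>

text \<open>AM-GM for \<open>e\<close> and \<open>B * d\<close>. It converts a linear term into a
  square, because on \<open>I\<close> only the square integral of the differences is known to tend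
  to 0.\<close>

lemma mult_le_young: "B * d \<le> e + B\<^sup>2 / e * d\<^sup>2" if "e > 0" for B d e :: real
proof -
  have "e * (B\<^sup>2 / e * d\<^sup>2) = (B * d)\<^sup>2" using that by (simp add: power_mult_distrib)
  then have eq: "e * (e + B\<^sup>2 / e * d\<^sup>2) = e\<^sup>2 + (B * d)\<^sup>2"
    by (simp only: ring_distribs power2_eq_square[of e])
  have "2 * (e * (B * d)) \<le> e\<^sup>2 + (B * d)\<^sup>2"
    using sum_squares_bound[of e "B * d"] by (simp only: mult.assoc)
  moreover have "0 \<le> e\<^sup>2 + (B * d)\<^sup>2" by simp
  ultimately have "e * (B * d) \<le> e * (e + B\<^sup>2 / e * d\<^sup>2)" unfolding eq by linarith
  then show ?thesis using that by (simp only: mult_le_cancel_left_pos)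
qed

lemma integral_norm_bound_AE:
  fixes f :: "'a \<Rightarrow> 'b::{banach, second_countable_topology}"
  assumes "integrable M w" and b: "AE x in M. norm (f x) \<le> w x"
  shows "norm (\<integral>x. f x \<partial>M) \<le> (\<integral>x. w x \<partial>M)"
proof -
  have "norm (\<integral>x. f x \<partial>M) \<le> (\<integral>x. norm (f x) \<partial>M)" by (rule integral_norm_bound)
  also have "\<dots> \<le> (\<integral>x. w x \<partial>M)"
    by (rule integral_mono_AE'[OF assms]) (use b in eventually_elim, rule order_trans[OF norm_ge_zero])
  finally show ?thesis .
qed

text \<open>The integral of \<open>d n * k * cis\<close> vanishes for every multiplier \<open>k\<close>, so \<open>\<Phi>\<close> may be replaced by
  \<open>\<Phi> - k * cis\<close>, which can be made small in \<open>L\<^sup>1\<close> off \<open>I\<close> while \<open>k\<close> stays bounded on \<open>I\<close>.\<close>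

lemma H2_weakly_null:
  fixes d :: "nat \<Rightarrow> real \<Rightarrow> complex" and M :: real
  assumes I: "I \<in> sets lebesgue" "I \<subseteq> Tcirc" "emeasure lebesgue I > 0"
    and d: "\<And>n. H2 (d n)" and M: "M \<ge> 0" "\<And>n. AE x in circ. x \<notin> I \<longrightarrow> norm (d n x) \<le> M"
    and N: "(\<lambda>n. \<integral>x. indicator I x * (norm (d n x))\<^sup>2 \<partial>circ) \<longlonglongrightarrow> 0"
    and \<Phi>: "integrable circ \<Phi>" "\<And>x. x \<in> I \<Longrightarrow> \<Phi> x = 0"
  shows "(\<lambda>n. \<integral>x. d n x * \<Phi> x \<partial>circ) \<longlonglongrightarrow> 0"
proof (rule LIMSEQ_I)
  fix r :: real assume r: "r > 0"
  \<comment> \<open>The total error will be \<open>c * e\<close>: \<open>M * e\<close> from the L^1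
    approximation of \<open>\<Phi>\<close>, and \<open>(M + 1) * e\<close> integrated over the
    circle of length 2 pi.\<close>
  define c where "c = M + 2 * pi * (M + 1)"
  define e where "e = r / (2 * (c + 1))"
  have den: "c \<ge> 0" using M unfolding c_def by (intro add_nonneg_nonneg mult_nonneg_nonneg) auto
  have e: "e > 0" "c * e \<le> r / 2"
  proof -
    show e0: "e > 0" using r den by (simp add: e_def)
    have "(c + 1) * e = r / 2" unfolding e_def using den by (simp add: field_simps)
    then show "c * e \<le> r / 2" using e0 by (simp add: algebra_simps)
  qed
  obtain H where H: "continuous_on (sphere 0 1) H" "(\<integral>x. norm (\<Phi> x - H (cis x)) \<partial>circ) < e"
    by (rule L1_continuous_approx[OF \<Phi>(1) e(1)]) (rule that)
  \<comment> \<open>The factor \<open>cnj z\<close> compensates the \<open>cis\<close> in the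
    vanishing integral: for functions of analytic type only positive powers of \<open>cis\<close>
    annihilate.\<close>
  have "multiplier_approximable I (\<lambda>z. cnj z * H z)"
    by (rule multiplier_approximable_continuous[OF I]) (intro continuous_intros H)
  then obtain k where k: "multiplier k" "AE x in circ. x \<notin> I \<longrightarrow> norm (k x - cnj (cis x) * H (cis x)) \<le> e"
    unfolding multiplier_approximable_def using e(1) by blast
  obtain B where B: "AE x in circ. norm (k x) \<le> B" using k(1) by (auto simp: multiplier_def)
  have km [measurable]: "k \<in> borel_measurable circ" using k(1) by (simp add: multiplier_def)
  have Hm [measurable]: "(\<lambda>x. H (cis x)) \<in> borel_measurable circ"
    by (rule continuous_circle_measurable[OF H(1)])
  have \<Phi>m [measurable]: "\<Phi> \<in> borel_measurable circ" using \<Phi>(1) by simp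
  have dm [measurable]: "d n \<in> borel_measurable circ" for n using d[of n] by (simp add: H2_iff in_L2_def)
  obtain BH where BH: "BH > 0" "\<And>x. norm (H (cis x)) \<le> BH" by (rule circle_bounded[OF H(1)]) (rule that)
  have iH: "integrable circ (\<lambda>x. norm (\<Phi> x - H (cis x)))"
    using \<Phi>(1) BH by (intro integrable_norm Bochner_Integration.integrable_diff integrable_circ_bounded[OF Hm, of BH]) auto
  have idN: "integrable circ (\<lambda>x. indicator I x * (norm (d n x))\<^sup>2)" for n
    using integrable_mult_indicator[OF sets_circ[OF I(1,2)], of "\<lambda>x. (norm (d n x))\<^sup>2"] d[of n]
    by (simp add: H2_iff in_L2_def)
  have ie: "integrable circ (\<lambda>x. (M + 1) * e)" by (rule integrable_circ_bounded[of _ "\<bar>(M + 1) * e\<bar>"]) auto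
  have est: "norm (\<integral>x. d n x * \<Phi> x \<partial>circ)
      \<le> r / 2 + B\<^sup>2 / e * (\<integral>x. indicator I x * (norm (d n x))\<^sup>2 \<partial>circ)" for n
  proof -
    let ?w = "\<lambda>x. M * norm (\<Phi> x - H (cis x)) + ((M + 1) * e + B\<^sup>2 / e * (indicator I x * (norm (d n x))\<^sup>2))"
    have iw: "integrable circ ?w"
      by (intro Bochner_Integration.integrable_add integrable_mult_right iH ie idN)
    have kd: "analytic_type (\<lambda>x. k x * d n x)" using k(1) d[of n] by (simp add: multiplier_def H2_iff)
    from this[unfolded analytic_type_def, THEN conjunct2, rule_format, of 1]
    have z: "(\<integral>x. k x * d n x * cis x \<partial>circ) = 0" by simp
    have ik: "integrable circ (\<lambda>x. k x * d n x * cis x)"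
      using analytic_type_mult_cis[OF kd] by (simp add: analytic_type_def)
    have bnd: "AE x in circ. norm (d n x * (\<Phi> x - k x * cis x)) \<le> ?w x"
      using k(2) B M(2)[of n]
    proof eventually_elim
      case (elim x)
      have w0: "0 \<le> M * norm (\<Phi> x - H (cis x))" "0 \<le> M * e" using M e by simp_all
      show ?case
      proof (cases "x \<in> I")
        case True
        have "norm (d n x * (\<Phi> x - k x * cis x)) = norm (d n x) * norm (k x)"
          using \<Phi>(2)[OF True] by (simp add: norm_mult)
        also have "\<dots> \<le> B * norm (d n x)" using mult_right_mono[OF elim(2), of "norm (d n x)"] by (simp add: mult.commute)
        also have "\<dots> \<le> e + B\<^sup>2 / e * (norm (d n x))\<^sup>2" by (rule mult_le_young[OF e(1)])
        also have "\<dots> \<le> ?w x" using True w0 by (simp add: distrib_right)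
        finally show ?thesis .
      next
        case False
        have zz: "cnj (cis x) * cis x = 1" by (simp add: complex_norm_square[symmetric] mult.commute)
        have "(k x - cnj (cis x) * H (cis x)) * cis x = k x * cis x - (cnj (cis x) * cis x) * H (cis x)"
          by (simp add: algebra_simps)
        then have "\<Phi> x - k x * cis x = (\<Phi> x - H (cis x)) - (k x - cnj (cis x) * H (cis x)) * cis x"
          by (simp add: zz)
        also have "norm \<dots> \<le> norm (\<Phi> x - H (cis x)) + norm ((k x - cnj (cis x) * H (cis x)) * cis x)"
          by (rule norm_triangle_ineq4)
        also have "\<dots> \<le> norm (\<Phi> x - H (cis x)) + e" using elim False by (simp add: norm_mult)
        finally have "norm (d n x) * norm (\<Phi> x - k x * cis x) \<le> M * (norm (\<Phi> x - H (cis x)) + e)"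
          using elim False M by (intro mult_mono) auto
        also have "\<dots> \<le> ?w x" using False e(1) by (simp add: distrib_left distrib_right)
        finally show ?thesis by (simp add: norm_mult)
      qed
    qed
    have id: "integrable circ (\<lambda>x. d n x * (\<Phi> x - k x * cis x))"
    proof (rule Bochner_Integration.integrable_bound[OF iw])
      show "AE x in circ. norm (d n x * (\<Phi> x - k x * cis x)) \<le> norm (?w x)"
        using bnd by eventually_elim simp
    qed measurable
    have "(\<integral>x. d n x * \<Phi> x \<partial>circ) = (\<integral>x. d n x * (\<Phi> x - k x * cis x) + k x * d n x * cis x \<partial>circ)"
      by (simp add: algebra_simps)
    also have "\<dots> = (\<integral>x. d n x * (\<Phi> x - k x * cis x) \<partial>circ)"
      by (subst Bochner_Integration.integral_add[OF id ik]) (simp add: z)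
    also have "norm \<dots> \<le> (\<integral>x. ?w x \<partial>circ)" by (rule integral_norm_bound_AE[OF iw bnd])
    also have "\<dots> = M * (\<integral>x. norm (\<Phi> x - H (cis x)) \<partial>circ) +
        ((\<integral>x. (M + 1) * e \<partial>circ) + B\<^sup>2 / e * (\<integral>x. indicator I x * (norm (d n x))\<^sup>2 \<partial>circ))"
      using iH ie idN by (simp only: Bochner_Integration.integral_add Bochner_Integration.integrable_add
          integrable_mult_right integral_mult_right_zero)
    also have "\<dots> \<le> M * e + (2 * pi * ((M + 1) * e) + B\<^sup>2 / e * (\<integral>x. indicator I x * (norm (d n x))\<^sup>2 \<partial>circ))"
      using M(1) H(2) e(1) by (intro add_mono mult_left_mono) (auto simp: integral_circ_const)
    also have "\<dots> \<le> r / 2 + B\<^sup>2 / e * (\<integral>x. indicator I x * (norm (d n x))\<^sup>2 \<partial>circ)"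
      using e(2) by (simp add: c_def algebra_simps)
    finally show ?thesis .
  qed
  \<comment> \<open>Both \<open>e\<close> and the multiplier, hence \<open>B\<close>, are fixed
    before \<open>n\<close> grows, so even a huge \<open>B\<close> multiplies a null
    sequence.\<close>
  have "(\<lambda>n. B\<^sup>2 / e * (\<integral>x. indicator I x * (norm (d n x))\<^sup>2 \<partial>circ)) \<longlonglongrightarrow> B\<^sup>2 / e * 0"
    by (intro tendsto_intros N)
  from order_tendstoD(2)[OF this, of "r/2"]
  have "eventually (\<lambda>n. B\<^sup>2 / e * (\<integral>x. indicator I x * (norm (d n x))\<^sup>2 \<partial>circ) < r / 2) sequentially"
    using r by simp
  then obtain n0 where n0: "\<And>n. n \<ge> n0 \<Longrightarrow> B\<^sup>2 / e * (\<integral>x. indicator I x * (norm (d n x))\<^sup>2 \<partial>circ) < r / 2"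
    unfolding eventually_sequentially by blast
  show "\<exists>n0. \<forall>n\<ge>n0. norm ((\<integral>x. d n x * \<Phi> x \<partial>circ) - 0) < r"
  proof (intro exI[of _ n0] allI impI)
    fix n assume "n \<ge> n0"
    from le_less_trans[OF est add_strict_left_mono[OF n0[OF this]]]
    show "norm ((\<integral>x. d n x * \<Phi> x \<partial>circ) - 0) < r" by simp
  qed
qed

text \<open>Away from 0 the periodic extension agrees locally with \<open>I\<close>, so interiors on
  the line and on the circle coincide. The angle 0 is an exception: it is never interior on the line
  to a subset of \<open>Tcirc\<close>, whatever happens across the gluing point.\<close>

lemma interior_diff_subset_circ_boundary:
  assumes "I \<subseteq> Tcirc"
  shows "I - interior I \<subseteq> circ_boundary I \<union> {0}"
proof
  fix x assume x: "x \<in> I - interior I"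
  let ?P = "{x. 2*pi * frac (x / (2*pi)) \<in> I}"
  have per: "2*pi * frac (y / (2*pi)) = y" if "0 < y" "y < 2*pi" for y
    using that frac_eq[of "y / (2*pi)"] by simp
  show "x \<in> circ_boundary I \<union> {0}"
  proof (cases "x = 0")
    case False
    then have x': "0 < x" "x < 2*pi" "x \<in> Tcirc" using x assms by (auto simp: Tcirc_def)
    have "x \<in> ?P" using x per[OF x'(1,2)] by simp
    moreover have "x \<notin> interior ?P"
    proof
      assume "x \<in> interior ?P"
      then have "x \<in> interior ?P \<inter> {0<..<2*pi}" using x' by simp
      moreover have "interior ?P \<inter> {0<..<2*pi} \<subseteq> I" using per interior_subset[of ?P] by force
      moreover have "open (interior ?P \<inter> {0<..<2*pi})" by auto
      ultimately have "x \<in> interior I" by (meson interiorI)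
      then show False using x by simp
    qed
    ultimately have "x \<in> frontier ?P" using closure_subset[of ?P] by (auto simp: frontier_def)
    then show ?thesis using x' by (simp add: circ_boundary_def)
  qed simp
qed

text \<open>The admissible variations are \<open>g0 + t * (k - e * g0)\<close> where \<open>k\<close> is within \<open>e\<close> of \<open>\<psi>\<close> off \<open>E\<close>:
  shrinking \<open>g0\<close> by the factor \<open>1 - t * e\<close> leaves room for \<open>t * k\<close> where \<open>\<psi>\<close> vanishes, and on \<open>E\<close>
  there is room for any bounded \<open>k\<close>.\<close>

lemma BEP_sol_saturated_or_trace:
  fixes \<delta> :: real
  assumes I: "I \<in> sets lebesgue" "I \<subseteq> Tcirc" and bd: "emeasure lebesgue (circ_boundary I) = 0"
    and f: "in_L2 I f" and sol: "BEP_sol I f g0"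
    and E: "E \<in> sets lebesgue" "E \<subseteq> Tcirc - I" "emeasure lebesgue E > 0"
    and \<delta>: "\<delta> > 0" "AE x in circ. x \<in> E \<longrightarrow> norm (g0 x) \<le> 1 - \<delta>"
  shows "AE x in lebesgue_on I. g0 x = f x"
proof -
  let ?M = "lebesgue_on I"
  define D where "D x = f x - g0 x" for x
  have adm0: "BEP_adm (Tcirc - I) g0" using sol by (simp add: BEP_sol_def)
  then have H0: "H2 g0" and b0: "AE x in circ. x \<notin> I \<longrightarrow> norm (g0 x) \<le> 1" by (auto simp: BEP_adm_circ[OF I(1)])
  have g0L: "in_L2 I g0" using H0 in_L2_subset[OF I] by (simp add: H2_def)
  have DL: "in_L2 I D" unfolding D_def by (rule in_L2_diff[OF f g0L])
  have Ilm: "I \<in> lmeasurable" using fmeasurableI2[OF Tcirc_lmeasurable I(2,1)] .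
  have iD: "integrable ?M D" by (rule in_L2_integrable[OF Ilm DL])
  have Dm [measurable]: "D \<in> borel_measurable ?M" using iD by simp
  have cnjm [measurable]: "cnj \<in> borel_measurable borel"
    by (intro borel_measurable_continuous_onI continuous_intros)
  have circM: "h \<in> borel_measurable ?M" if "h \<in> borel_measurable circ" for h :: "real \<Rightarrow> complex"
    using that unfolding lebesgue_on_circ[OF I] by (rule measurable_restrict_space1)
  \<comment> \<open>The function \<open>\<psi>\<close> need not be analytic and so is no legitimate
    direction. Its approximant \<open>k\<close> yields one, and the inequality then holds up to an
    error linear in \<open>e\<close>, which is removed by letting \<open>e\<close> tend to
    0.\<close>
  have orth: "Re (\<integral>x. D x * cnj (\<psi> (cis x)) \<partial>?M) \<le> 0"
    if \<psi>: "continuous_on (sphere 0 1) \<psi>" "\<And>x. x \<in> Tcirc - I \<Longrightarrow> \<psi> (cis x) = 0" for \<psi>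
  proof (rule nonpos_if_le_linear[of 1])
    fix e :: real assume e: "0 < e" "e \<le> 1"
    have "multiplier_approximable E \<psi>"
      by (rule multiplier_approximable_continuous) (use E \<psi> in auto)
    then obtain k where k: "multiplier k" "AE x in circ. x \<notin> E \<longrightarrow> norm (k x - \<psi> (cis x)) \<le> e"
      unfolding multiplier_approximable_def using e(1) by blast
    obtain B where B: "AE x in circ. norm (k x) \<le> B" using k(1) by (auto simp: multiplier_def)
    have km: "k \<in> borel_measurable circ" and Hk: "H2 k"
      using k(1) H2_1 unfolding multiplier_def by (auto dest: spec[of _ "\<lambda>x. 1"])
    have kL: "in_L2 I k" using Hk in_L2_subset[OF I] by (simp add: H2_def)
    define h where "h x = k x - of_real e * g0 x" for x
    have Hh: "H2 h" unfolding h_def by (intro H2_diff H2_cmult Hk H0)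
    \<comment> \<open>The quotient makes \<open>t * \<bar>B\<bar>\<close> at most the gap
      \<open>\<delta>\<close> available on \<open>E\<close>; the bound 1 keeps
      \<open>1 - t * e\<close> nonnegative.\<close>
    define t0 where "t0 = min 1 (\<delta> / (\<bar>B\<bar> + 1))"
    have t0: "t0 > 0" using \<delta>(1) by (simp add: t0_def)
    have adm: "BEP_adm (Tcirc - I) (\<lambda>x. g0 x + of_real t * h x)" if t: "0 < t" "t \<le> t0" for t
    proof -
      have t1: "t \<le> 1" using t by (simp add: t0_def)
      have te: "0 \<le> 1 - t * e" "1 - t * e \<le> 1" using t1 t e mult_mono[of t 1 e 1] by auto
      have "t \<le> \<delta> / (\<bar>B\<bar> + 1)" using t by (simp add: t0_def)
      then have "t * (\<bar>B\<bar> + 1) \<le> \<delta>" by (subst (asm) pos_le_divide_eq) auto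
      then have tB: "t * \<bar>B\<bar> \<le> \<delta>" using t by (simp add: algebra_simps)
      have "AE x in circ. x \<in> Tcirc" by (metis AE_space space_lebesgue_on)
      then have "AE x in circ. x \<notin> I \<longrightarrow> norm (g0 x + of_real t * h x) \<le> 1"
        using b0 B k(2) \<delta>(2)
      proof eventually_elim
        case (elim x)
        have eq: "g0 x + of_real t * h x = of_real (1 - t * e) * g0 x + of_real t * k x"
          by (simp add: h_def algebra_simps)
        have le: "norm (g0 x + of_real t * h x) \<le> (1 - t * e) * norm (g0 x) + t * norm (k x)"
          unfolding eq using norm_triangle_ineq[of "of_real (1 - t * e) * g0 x" "of_real t * k x"] te t
          by (simp only: norm_mult norm_of_real)
        show ?case
        proof
          assume xI: "x \<notin> I"
          show "norm (g0 x + of_real t * h x) \<le> 1"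
          proof (cases "x \<in> E")
            case True
            have "(1 - t * e) * norm (g0 x) \<le> 1 * (1 - \<delta>)" using te elim True by (intro mult_mono) auto
            moreover have "t * norm (k x) \<le> t * \<bar>B\<bar>" using t elim by (intro mult_left_mono) auto
            ultimately have "norm (g0 x + of_real t * h x) \<le> (1 - \<delta>) + \<delta>"
              using order_trans[OF le add_mono] tB by (metis mult_1 order_trans)
            then show ?thesis by simp
          next
            case False
            have "norm (k x) \<le> e" using elim False xI \<psi>(2)[of x] by simp
            then have "t * norm (k x) \<le> t * e" using t by (intro mult_left_mono) auto
            moreover have "(1 - t * e) * norm (g0 x) \<le> (1 - t * e) * 1"
              using te elim xI by (intro mult_left_mono) auto
            ultimately have "norm (g0 x + of_real t * h x) \<le> (1 - t * e) * 1 + t * e"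
              using order_trans[OF le add_mono] by blast
            then show ?thesis by simp
          qed
        qed
      qed
      then show ?thesis by (auto simp: BEP_adm_circ[OF I(1)] intro!: H2_add H2_cmult H0 Hh)
    qed
    have V: "Re (\<integral>x. D x * cnj (h x) \<partial>?M) \<le> 0"
      unfolding D_def by (rule BEP_sol_variation[OF I f sol Hh t0 adm])
    have \<psi>m: "(\<lambda>x. \<psi> (cis x)) \<in> borel_measurable ?M"
      by (rule circM[OF continuous_circle_measurable[OF \<psi>(1)]])
    note [measurable] = \<psi>m circM[OF km]
    \<comment> \<open>As \<open>E\<close> lies in J, the approximation holds on all of
      \<open>I\<close>.\<close>
    have AE_E: "AE x in ?M. norm (\<psi> (cis x) - k x) \<le> e"
      unfolding AE_lebesgue_on_circ[OF I] using k(2)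
      by eventually_elim (use E(2) in \<open>auto simp: norm_minus_commute\<close>)
    have i1: "integrable ?M (\<lambda>x. D x * cnj (\<psi> (cis x) - k x))"
      by (rule integrable_mult_bounded[OF iD _, of _ e]) (use AE_E in \<open>simp_all flip: complex_cnj_diff\<close>)
    have i2: "integrable ?M (\<lambda>x. D x * cnj (h x))"
      unfolding h_def by (intro integrable_mult_cnj_L2 DL in_L2_diff kL in_L2_cmult g0L)
    have i3: "integrable ?M (\<lambda>x. of_real e * (D x * cnj (g0 x)))"
      by (intro integrable_mult_right integrable_mult_cnj_L2 DL g0L)
    \<comment> \<open>Splitting \<open>\<psi>\<close> as \<open>(\<psi> - k) + h + e * g0\<close>
      leaves one term governed by the variational inequality and two of order
      \<open>e\<close>.\<close>
    have "(\<integral>x. D x * cnj (\<psi> (cis x)) \<partial>?M)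
        = (\<integral>x. D x * cnj (\<psi> (cis x) - k x) + (D x * cnj (h x) + of_real e * (D x * cnj (g0 x))) \<partial>?M)"
      by (simp add: h_def algebra_simps)
    also have "\<dots> = (\<integral>x. D x * cnj (\<psi> (cis x) - k x) \<partial>?M) +
        ((\<integral>x. D x * cnj (h x) \<partial>?M) + of_real e * (\<integral>x. D x * cnj (g0 x) \<partial>?M))"
      using i1 i2 i3 by (simp only: Bochner_Integration.integral_add Bochner_Integration.integrable_add integral_mult_right_zero)
    finally have eq: "Re (\<integral>x. D x * cnj (\<psi> (cis x)) \<partial>?M) = Re (\<integral>x. D x * cnj (\<psi> (cis x) - k x) \<partial>?M) +
        (Re (\<integral>x. D x * cnj (h x) \<partial>?M) + e * Re (\<integral>x. D x * cnj (g0 x) \<partial>?M))" by simp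
    have "norm (\<integral>x. D x * cnj (\<psi> (cis x) - k x) \<partial>?M) \<le> (\<integral>x. e * norm (D x) \<partial>?M)"
    proof (rule integral_norm_bound_AE)
      show "integrable ?M (\<lambda>x. e * norm (D x))" using iD by auto
      show "AE x in ?M. norm (D x * cnj (\<psi> (cis x) - k x)) \<le> e * norm (D x)"
        using AE_E
      proof eventually_elim
        case (elim x)
        have "norm (D x) * norm (\<psi> (cis x) - k x) \<le> norm (D x) * e" using elim by (intro mult_left_mono) auto
        then show ?case by (simp only: norm_mult complex_mod_cnj mult.commute)
      qed
    qed
    then have "Re (\<integral>x. D x * cnj (\<psi> (cis x) - k x) \<partial>?M) \<le> e * (\<integral>x. norm (D x) \<partial>?M)"
      using order_trans[OF complex_Re_le_cmod] by simp
    then show "Re (\<integral>x. D x * cnj (\<psi> (cis x)) \<partial>?M)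
        \<le> e * ((\<integral>x. norm (D x) \<partial>?M) + Re (\<integral>x. D x * cnj (g0 x) \<partial>?M))"
      unfolding eq using V by (simp add: algebra_simps)
  qed simp
  \<comment> \<open>The phase of \<open>D\<close>: the pairing of \<open>D\<close> with
    \<open>u\<close> is the integral of |D|, so test functions tending to \<open>u\<close> force
    \<open>D\<close> to vanish.\<close>
  define u where "u x = (if x \<in> I then sgn (D x) else 0)" for x
  have um: "u \<in> borel_measurable circ"
  proof -
    have "(\<lambda>x. sgn (D x)) \<in> borel_measurable ?M" by measurable
    then show ?thesis
      unfolding u_def[abs_def] by (subst borel_measurable_if_lebesgue_on[OF I(1) Tcirc_sets I(2)])
  qed
  have ub: "norm (u x) \<le> 1" for x by (simp add: u_def norm_sgn)
  obtain H where H: "\<And>n. continuous_on (sphere 0 1) (H n)"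
      "\<And>n z. z \<in> sphere 0 1 \<Longrightarrow> norm (H n z) \<le> 1"
      "AE x in circ. (\<lambda>n. H n (cis x)) \<longlonglongrightarrow> u x"
    by (rule bounded_continuous_approx[OF um ub]) (rule that)
  \<comment> \<open>This cutoff is zero off the interior of \<open>I\<close>, so that the test
    functions vanish on J, and equals 1 eventually at every interior point.\<close>
  define a where "a n x = min 1 (real n * infdist x (- interior I))" for n x
  \<comment> \<open>Neither end is interior, so the cutoff is 0 at both and descends to a continuous
    function on the circle.\<close>
  have ends: "0 \<notin> interior I" "2 * pi \<notin> interior I"
  proof -
    have "interior I \<subseteq> interior {0..2*pi}" using I(2) by (intro interior_mono) (auto simp: Tcirc_def)
    then show "0 \<notin> interior I" "2 * pi \<notin> interior I" by auto
  qed
  have "\<exists>A. continuous_on (sphere 0 1) A \<and> (\<forall>x\<in>{0..2*pi}. A (cis x) = complex_of_real (a n x))" for n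
    by (rule circle_quotient[of "\<lambda>x. complex_of_real (a n x)"])
       (use ends in \<open>auto simp: a_def intro!: continuous_intros\<close>)
  then obtain A where A: "\<And>n. continuous_on (sphere 0 1) (A n)"
      "\<And>n x. x \<in> {0..2*pi} \<Longrightarrow> A n (cis x) = complex_of_real (a n x)"
    by metis
  have A': "A n (cis x) = complex_of_real (a n x)" if "x \<in> Tcirc" for n x
    using A(2)[of x n] that by (auto simp: Tcirc_def)
  have a1: "\<bar>a n x\<bar> \<le> 1" for n x using infdist_nonneg[of x "- interior I"] by (simp add: a_def)
  define \<psi> where "\<psi> n z = A n z * H n z" for n z
  have \<psi>c: "continuous_on (sphere 0 1) (\<psi> n)" for n unfolding \<psi>_def by (intro continuous_intros A H)
  have \<psi>0: "\<psi> n (cis x) = 0" if "x \<in> Tcirc - I" for n x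
  proof -
    have "x \<in> - interior I" using that interior_subset by auto
    then have "a n x = 0" by (simp add: a_def)
    then show ?thesis using A' that by (simp add: \<psi>_def)
  qed
  have nn: "Re (\<integral>x. D x * cnj (\<psi> n (cis x)) \<partial>?M) \<le> 0" for n by (rule orth[OF \<psi>c \<psi>0])
  have lim: "(\<lambda>n. \<integral>x. D x * cnj (\<psi> n (cis x)) \<partial>?M) \<longlonglongrightarrow> (\<integral>x. complex_of_real (norm (D x)) \<partial>?M)"
  proof (rule integral_dominated_convergence[where w = "\<lambda>x. norm (D x)"])
    have "AE x in ?M. (\<lambda>n. H n (cis x)) \<longlonglongrightarrow> u x"
      unfolding AE_lebesgue_on_circ[OF I] using H(3) by eventually_elim simp
    \<comment> \<open>The hypothesis on the boundary is used here: without it the cutoffs could miss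
      a part of \<open>I\<close> of positive measure.\<close>
    moreover have "AE x in ?M. x \<in> interior I"
    proof -
      have "closed (frontier {x. 2*pi * frac (x / (2*pi)) \<in> I})" by (rule frontier_closed)
      then have "circ_boundary I \<in> sets lebesgue"
        unfolding circ_boundary_def using Tcirc_sets by (intro sets.Int) auto
      then have "circ_boundary I \<in> null_sets lebesgue" using bd by (simp add: null_sets_def)
      then have "circ_boundary I \<union> {0} \<in> null_sets lebesgue" by (intro null_sets.Un) auto
      then have "AE x in lebesgue. x \<notin> circ_boundary I \<union> {0}" by (rule AE_not_in)
      then have "AE x in lebesgue. x \<in> I \<longrightarrow> x \<in> interior I"
        by eventually_elim (use interior_diff_subset_circ_boundary[OF I(2)] in blast)
      then show ?thesis using I(1) by (subst AE_restrict_space_iff) auto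
    qed
    ultimately show "AE x in ?M. (\<lambda>n. D x * cnj (\<psi> n (cis x))) \<longlonglongrightarrow> complex_of_real (norm (D x))"
    proof eventually_elim
      case (elim x)
      have xI: "x \<in> I" "x \<in> Tcirc" using elim(2) interior_subset I(2) by auto
      \<comment> \<open>Distance to the empty set is 0 by convention; \<open>ends(1)\<close> shows
        that the complement is nonempty.\<close>
      have "infdist x (- interior I) > 0"
        using elim(2) ends(1) in_closed_iff_infdist_zero[of "- interior I" x] infdist_nonneg[of x "- interior I"]
        by (force simp: less_le)
      then obtain n0 :: nat where n0: "1 < real n0 * infdist x (- interior I)" using reals_Archimedean3 by blast
      have "a n x = 1" if "n \<ge> n0" for n
      proof -
        have "real n0 * infdist x (- interior I) \<le> real n * infdist x (- interior I)"
          using that infdist_nonneg by (intro mult_right_mono) auto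
        then show ?thesis using n0 unfolding a_def by auto
      qed
      then have ev: "eventually (\<lambda>n. H n (cis x) = \<psi> n (cis x)) sequentially"
        unfolding eventually_sequentially \<psi>_def using A'[OF xI(2)] by (intro exI[of _ n0]) auto
      have "(\<lambda>n. \<psi> n (cis x)) \<longlonglongrightarrow> u x" using Lim_transform_eventually[OF elim(1) ev] .
      then have "(\<lambda>n. D x * cnj (\<psi> n (cis x))) \<longlonglongrightarrow> D x * cnj (u x)" by (intro tendsto_intros)
      moreover have "D x * cnj (u x) = complex_of_real (norm (D x))"
        using xI by (cases "D x = 0") (simp_all add: u_def sgn_div_norm scaleR_conv_of_real divide_inverse
            complex_norm_square[symmetric] power2_eq_square mult.left_commute[of "D x"])
      ultimately show ?case by simp
    qed
    show "AE x in ?M. norm (D x * cnj (\<psi> n (cis x))) \<le> norm (D x)" for n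
    proof (rule AE_I2)
      fix x assume "x \<in> space ?M"
      then have "x \<in> Tcirc" using I(2) by auto
      then have "norm (\<psi> n (cis x)) = \<bar>a n x\<bar> * norm (H n (cis x))" by (simp add: \<psi>_def A' norm_mult)
      also have "\<dots> \<le> 1 * 1" using a1 H(2)[OF sphere_cis] by (intro mult_mono) auto
      finally show "norm (D x * cnj (\<psi> n (cis x))) \<le> norm (D x)" by (simp add: norm_mult mult_left_le)
    qed
    show "integrable ?M (\<lambda>x. norm (D x))" using iD by simp
    show "(\<lambda>x. D x * cnj (\<psi> n (cis x))) \<in> borel_measurable ?M" for n
    proof -
      note [measurable] = circM[OF continuous_circle_measurable[OF \<psi>c[of n]]]
      show ?thesis by measurable
    qed
  qed measurable
  have "Re (\<integral>x. complex_of_real (norm (D x)) \<partial>?M) \<le> 0"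
    using tendsto_Re[OF lim] nn by (intro tendsto_upperbound) auto
  then have "(\<integral>x. norm (D x) \<partial>?M) = 0" by (simp add: order_antisym integral_nonneg_AE)
  then have "AE x in ?M. norm (D x) = 0"
    using iD by (subst (asm) integral_nonneg_eq_0_iff_AE) auto
  then show ?thesis by eventually_elim (simp add: D_def)
qed

text \<open>The part of J where |g0| < 1 is, up to a null set, a countable union of sets
  \<open>E n\<close> with a fixed gap \<open>1 / Suc n\<close>. If one of them had positive measure,
  \<open>g0\<close> itself would be an admissible function with trace \<open>f\<close>, which is
  excluded.\<close>

lemma BEP_sol_saturated:
  assumes I: "I \<in> sets lebesgue" "I \<subseteq> Tcirc" and bd: "emeasure lebesgue (circ_boundary I) = 0"
    and f: "in_L2 I f" and sol: "BEP_sol I f g0"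
    and nt: "\<not> (\<exists>h. BEP_adm (Tcirc - I) h \<and> (AE x in lebesgue_on I. h x = f x))"
  shows "AE x in circ. x \<notin> I \<longrightarrow> norm (g0 x) = 1"
proof -
  have adm: "BEP_adm (Tcirc - I) g0" using sol by (simp add: BEP_sol_def)
  then have b: "AE x in circ. x \<notin> I \<longrightarrow> norm (g0 x) \<le> 1"
    and gm [measurable]: "g0 \<in> borel_measurable circ"
    by (auto simp: BEP_adm_circ[OF I(1)] H2_iff in_L2_def)
  define E where "E n = {x \<in> Tcirc. norm (g0 x) \<le> 1 - 1 / real (Suc n)} - I" for n
  have Ec: "E n \<in> sets circ" for n
  proof -
    have "{x \<in> space circ. norm (g0 x) \<le> 1 - 1 / real (Suc n)} \<in> sets circ" by measurable
    then show ?thesis unfolding E_def using sets_circ[OF I] by auto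
  qed
  then have El: "E n \<in> sets lebesgue" for n
    using Ec[of n] Tcirc_sets by (simp add: sets_restrict_space_iff)
  have Es: "E n \<subseteq> Tcirc - I" for n by (auto simp: E_def)
  have "emeasure lebesgue (E n) = 0" for n
  proof (rule ccontr)
    assume "emeasure lebesgue (E n) \<noteq> 0"
    then have "emeasure lebesgue (E n) > 0" by (simp add: zero_less_iff_neq_zero)
    then have "AE x in lebesgue_on I. g0 x = f x"
      by (rule BEP_sol_saturated_or_trace[OF I bd f sol El Es, of n "1 / real (Suc n)"]) (auto simp: E_def)
    then show False using nt adm by blast
  qed
  then have "E n \<in> null_sets circ" for n
    using El Es Tcirc_sets by (auto simp: null_sets_restrict_space)
  then have "AE x in circ. \<forall>n. x \<notin> E n"
    unfolding AE_all_countable by (auto intro: AE_not_in)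
  moreover have "AE x in circ. x \<in> Tcirc" by (metis AE_space space_lebesgue_on)
  ultimately show ?thesis using b
  proof eventually_elim
    case (elim x)
    show ?case
    proof
      assume xI: "x \<notin> I"
      have "\<not> norm (g0 x) < 1"
      proof
        assume "norm (g0 x) < 1"
        then obtain n where "inverse (real (Suc n)) < 1 - norm (g0 x)"
          using reals_Archimedean[of "1 - norm (g0 x)"] by auto
        then have "norm (g0 x) \<le> 1 - 1 / real (Suc n)"
          unfolding inverse_eq_divide less_diff_eq le_diff_eq by (simp only: add.commute less_imp_le)
        then have "x \<in> E n" using xI elim by (simp add: E_def)
        then show False using elim by blast
      qed
      then show "norm (g0 x) = 1" using elim xI by simp
    qed
  qed
qed

section \<open>Convergence of the solutions\<close>

theorem mainTheorem7:
  fixes I :: "real set" and f :: "real \<Rightarrow> complex" and g0 :: "real \<Rightarrow> complex"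
    and fn gn :: "nat \<Rightarrow> real \<Rightarrow> complex"
  assumes I_meas: "I \<in> sets lebesgue" and I_sub: "I \<subseteq> Tcirc"
    and I_pos: "emeasure lebesgue I > 0"
    and J_pos: "emeasure lebesgue (Tcirc - I) > 0"
    and f_L2: "in_L2 I f"
    and g0_sol: "BEP_sol I f g0"
    and fn_L2: "\<And>n. in_L2 I (fn n)"
    and fn_conv: "(\<lambda>n. L2norm I (\<lambda>x. fn n x - f x)) \<longlonglongrightarrow> 0"
    and gn_sol: "\<And>n. BEP_sol I (fn n) (gn n)"
  shows "(\<lambda>n. L2norm I (\<lambda>x. gn n x - g0 x)) \<longlonglongrightarrow> 0
    \<and> (\<forall>\<phi> :: real \<Rightarrow> complex. integrable (lebesgue_on (Tcirc - I)) \<phi> \<longrightarrow>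
         (\<lambda>n. integral\<^sup>L (lebesgue_on (Tcirc - I)) (\<lambda>x. (gn n x - g0 x) * \<phi> x)) \<longlonglongrightarrow> 0)
    \<and> ((emeasure lebesgue (circ_boundary I) = 0 \<and>
        \<not> (\<exists>h. BEP_adm (Tcirc - I) h \<and> (AE x in lebesgue_on I. h x = f x)))
       \<longrightarrow> (\<lambda>n. L2norm Tcirc (\<lambda>x. gn n x - g0 x)) \<longlonglongrightarrow> 0)"
proof -
  note I = I_meas I_sub
  have J: "Tcirc - I \<in> sets lebesgue" "Tcirc - I \<subseteq> Tcirc" using I Tcirc_sets by auto
  define d where "d n x = gn n x - g0 x" for n x
  have adm: "BEP_adm (Tcirc - I) g0" "\<And>n. BEP_adm (Tcirc - I) (gn n)"
    using g0_sol gn_sol by (auto simp: BEP_sol_def)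
  have Hd: "H2 (d n)" for n
    unfolding d_def using adm by (intro H2_diff) (auto simp: BEP_adm_def)
  have bnd0: "AE x in circ. x \<notin> I \<longrightarrow> norm (g0 x) \<le> 1"
    and bndn: "\<And>n. AE x in circ. x \<notin> I \<longrightarrow> norm (gn n x) \<le> 1"
    using adm by (auto simp: BEP_adm_circ[OF I(1)])
  have bd: "AE x in circ. x \<notin> I \<longrightarrow> norm (d n x) \<le> 2" for n
    using bnd0 bndn[of n]
  proof eventually_elim
    case (elim x)
    then show ?case using norm_triangle_ineq4[of "gn n x" "g0 x"] by (auto simp: d_def)
  qed
  have "(\<lambda>n. \<integral>x. (norm (d n x))\<^sup>2 \<partial>lebesgue_on I) \<longlonglongrightarrow> 0"
  proof (rule tendsto_sandwich[OF _ _ tendsto_const])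
    show "(\<lambda>n. \<integral>x. (norm (fn n x - f x))\<^sup>2 \<partial>lebesgue_on I) \<longlonglongrightarrow> 0"
      using fn_conv by (simp only: L2norm_tendsto_0_iff)
    show "\<forall>\<^sub>F n in sequentially. (\<integral>x. (norm (d n x))\<^sup>2 \<partial>lebesgue_on I)
        \<le> (\<integral>x. (norm (fn n x - f x))\<^sup>2 \<partial>lebesgue_on I)"
      unfolding d_def
      by (intro always_eventually allI BEP_sol_nonexpansive[OF I f_L2 g0_sol fn_L2 gn_sol])
    show "\<forall>\<^sub>F n in sequentially. 0 \<le> (\<integral>x. (norm (d n x))\<^sup>2 \<partial>lebesgue_on I)"
      by (intro always_eventually allI integral_nonneg_AE) simp
  qed
  then have part1: "(\<lambda>n. L2norm I (\<lambda>x. gn n x - g0 x)) \<longlonglongrightarrow> 0"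
    and N: "(\<lambda>n. \<integral>x. indicator I x * (norm (d n x))\<^sup>2 \<partial>circ) \<longlonglongrightarrow> 0"
    by (simp_all add: L2norm_tendsto_0_iff d_def integral_lebesgue_on_circ[OF I])
  have weak: "(\<lambda>n. \<integral>x. d n x * \<Phi> x \<partial>circ) \<longlonglongrightarrow> 0"
    if "integrable circ \<Phi>" "\<And>x. x \<in> I \<Longrightarrow> \<Phi> x = 0" for \<Phi>
    using H2_weakly_null[where d = d and M = 2, OF I I_pos Hd _ bd N that] by simp
  have part2: "(\<lambda>n. \<integral>x. (gn n x - g0 x) * \<phi> x \<partial>lebesgue_on (Tcirc - I)) \<longlonglongrightarrow> 0"
    if \<phi>: "integrable (lebesgue_on (Tcirc - I)) \<phi>" for \<phi> :: "real \<Rightarrow> complex"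
  proof -
    have "(\<lambda>n. \<integral>x. d n x * (indicator (Tcirc - I) x *\<^sub>R \<phi> x) \<partial>circ) \<longlonglongrightarrow> 0"
      by (rule weak) (use \<phi> in \<open>auto simp: integrable_lebesgue_on_circ[OF J]\<close>)
    then show ?thesis by (simp add: integral_lebesgue_on_circ[OF J] d_def)
  qed
  have part3: "(\<lambda>n. L2norm Tcirc (\<lambda>x. gn n x - g0 x)) \<longlonglongrightarrow> 0"
    if bdry: "emeasure lebesgue (circ_boundary I) = 0"
      and nt: "\<not> (\<exists>h. BEP_adm (Tcirc - I) h \<and> (AE x in lebesgue_on I. h x = f x))"
  proof -
    have sat: "AE x in circ. x \<notin> I \<longrightarrow> norm (g0 x) = 1"
      by (rule BEP_sol_saturated[OF I bdry f_L2 g0_sol nt])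
    \<comment> \<open>Weak convergence is tested against the limit itself: \<open>cnj g0\<close> on
      J, extended by zero to \<open>I\<close>.\<close>
    define \<Phi> where "\<Phi> x = indicator (Tcirc - I) x *\<^sub>R cnj (g0 x)" for x
    have i0: "integrable circ g0"
      using adm(1) in_L2_integrable[OF Tcirc_lmeasurable] by (auto simp: BEP_adm_def H2_def)
    have i\<Phi>: "integrable circ \<Phi>"
      unfolding \<Phi>_def by (intro integrable_mult_indicator sets_circ J) (use i0 in simp)
    have lim: "(\<lambda>n. \<integral>x. d n x * \<Phi> x \<partial>circ) \<longlonglongrightarrow> 0"
      by (rule weak[OF i\<Phi>]) (simp add: \<Phi>_def)
    have dm: "d n \<in> borel_measurable circ" and d2: "integrable circ (\<lambda>x. (norm (d n x))\<^sup>2)" for n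
      using Hd[of n] by (auto simp: H2_iff in_L2_def)
    have \<Phi>b: "AE x in circ. norm (\<Phi> x) \<le> 1"
      using bnd0 by eventually_elim (auto simp: \<Phi>_def indicator_def)
    have id\<Phi>: "integrable circ (\<lambda>x. d n x * \<Phi> x)" for n
      by (rule integrable_mult_bounded[OF _ _ \<Phi>b])
         (use Hd[of n] i\<Phi> in \<open>auto simp: H2_iff analytic_type_def\<close>)
    have idI: "integrable circ (\<lambda>x. indicator I x * (norm (d n x))\<^sup>2)" for n
      using integrable_mult_indicator[OF sets_circ[OF I] d2[of n]] by simp
    have "AE x in circ. x \<in> Tcirc" by (metis AE_space space_lebesgue_on)
    \<comment> \<open>Off \<open>I\<close>, |d|^2 + 2 Re (d * cnj g0) equals |gn|^2 - |g0|^2, which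
      is at most 0 since |g0| = 1 there. The square norm on J is thus dominated by a term that tends
      to 0 weakly.\<close>
    then have pw: "AE x in circ. (norm (d n x))\<^sup>2 \<le> indicator I x * (norm (d n x))\<^sup>2 - 2 * Re (d n x * \<Phi> x)" for n
      using sat bndn[of n]
    proof eventually_elim
      case (elim x)
      show ?case
      proof (cases "x \<in> I")
        case True
        then show ?thesis by (simp add: \<Phi>_def)
      next
        case False
        then have g: "norm (g0 x) = 1" "norm (gn n x) \<le> 1" and \<Phi>: "\<Phi> x = cnj (g0 x)"
          using elim by (auto simp: \<Phi>_def)
        have "(norm (d n x))\<^sup>2 + 2 * Re (d n x * \<Phi> x) = (norm (gn n x))\<^sup>2 - (norm (g0 x))\<^sup>2"
          unfolding \<Phi> d_def cmod_power2 by (simp add: power2_eq_square algebra_simps)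
        also have "\<dots> \<le> 0" using g by (simp add: power_le_one)
        finally show ?thesis using False by simp
      qed
    qed
    have "(\<lambda>n. \<integral>x. (norm (d n x))\<^sup>2 \<partial>circ) \<longlonglongrightarrow> 0"
    proof (rule tendsto_sandwich[OF _ _ tendsto_const])
      show "\<forall>\<^sub>F n in sequentially. 0 \<le> (\<integral>x. (norm (d n x))\<^sup>2 \<partial>circ)"
        by (intro always_eventually allI integral_nonneg_AE) simp
      show "\<forall>\<^sub>F n in sequentially. (\<integral>x. (norm (d n x))\<^sup>2 \<partial>circ)
          \<le> (\<integral>x. indicator I x * (norm (d n x))\<^sup>2 \<partial>circ) - 2 * Re (\<integral>x. d n x * \<Phi> x \<partial>circ)"
      proof (intro always_eventually allI)
        fix n
        have iR: "integrable circ (\<lambda>x. 2 * Re (d n x * \<Phi> x))"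
          by (intro integrable_mult_right integrable_Re id\<Phi>)
        have "(\<integral>x. (norm (d n x))\<^sup>2 \<partial>circ)
            \<le> (\<integral>x. indicator I x * (norm (d n x))\<^sup>2 - 2 * Re (d n x * \<Phi> x) \<partial>circ)"
          by (intro integral_mono_AE d2 pw Bochner_Integration.integrable_diff idI iR)
        also have "\<dots> = (\<integral>x. indicator I x * (norm (d n x))\<^sup>2 \<partial>circ) - 2 * Re (\<integral>x. d n x * \<Phi> x \<partial>circ)"
          by (simp only: Bochner_Integration.integral_diff[OF idI iR] integral_mult_right_zero integral_Re[OF id\<Phi>])
        finally show "(\<integral>x. (norm (d n x))\<^sup>2 \<partial>circ)
            \<le> (\<integral>x. indicator I x * (norm (d n x))\<^sup>2 \<partial>circ) - 2 * Re (\<integral>x. d n x * \<Phi> x \<partial>circ)" .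
      qed
      have "(\<lambda>n. (\<integral>x. indicator I x * (norm (d n x))\<^sup>2 \<partial>circ) - 2 * Re (\<integral>x. d n x * \<Phi> x \<partial>circ))
          \<longlonglongrightarrow> 0 - 2 * Re 0"
        by (intro tendsto_intros N lim)
      then show "(\<lambda>n. (\<integral>x. indicator I x * (norm (d n x))\<^sup>2 \<partial>circ) - 2 * Re (\<integral>x. d n x * \<Phi> x \<partial>circ))
          \<longlonglongrightarrow> 0" by simp
    qed
    then show ?thesis by (simp add: L2norm_tendsto_0_iff d_def)
  qed
  show ?thesis using part1 part2 part3 by blast
qed

end
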